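(* Let $H$ be a graph with vertex set $\{v_1,\dots,v_k\}$, and let $G_1,\dots,G_k$ be graphs. Let $G_i$ have $n_i$ vertices and adjacency matrix $A_i$, and let $S_i\subseteq V(G_i)$ be nonempty for each $i$. Let $G=\bigvee_{H,\mathcal S}\{G_1,\dots,G_k\}$ be the $H$-generalized join constrained by $\mathcal S=\{S_1,\dots,S_k\}$. Let $\rho_{ij}=1$ if $v_iv_j\in E(H)$ and $0$ otherwise. Let $\phi_i(\lambda)=\det(\lambda I_{n_i}-A_i)$ and $\Gamma_i(\lambda)=\chi_{S_i}^t(\lambda I_{n_i}-A_i)^{-1}\chi_{S_i}$. (i) The characteristic polynomial of $G$ is $$\phi_G(\lambda)=\prod_{i=1}^k\phi_i(\lambda)\Gamma_i(\lambda)\cdot\det\widetilde A,$$ where $\widetilde A$ is the $k\times k$ matrix with diagonal entries $1/\Gamma_i(\lambda)$ and off-diagonal entries $-\rho_{ij}$. (ii) Let $\theta^{(i)}_1,\dots,\theta^{(i)}_{m_i}$ be the distinct $\chi_{S_i}$-main eigenvalues of $A_i$. Set $g_i(\lambda)=\prod_j(\lambda-\theta^{(i)}_j)$ and $f_i=g_i\Gamma_i$. Let $\Phi(\lambda)$ be the determinant of the $k\times k$ matrix with diagonal entries $g_i(\lambda)$ and off-diagonal $(i,j)$ entries $-\rho_{ij}f_i(\lambda)$. Then, as a multiset, the spectrum of $G$ consists of: - every eigenvalue of each $A_i$ that is not $\chi_{S_i}$-main, with its multiplicity in $A_i$; - every $\chi_{S_i}$-main eigenvalue of $A_i$, with multiplicity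 one less than its multiplicity in $A_i$; - the roots of $\Phi(\lambda)$.
   Context: All graphs are finite and simple. The $H$-generalized join $\bigvee_{H,\mathcal S}\{G_1,\dots,G_k\}$ has vertex set $\bigcup_iV(G_i)$ (disjoint union). Its edges are those of each $G_i$ together with all edges $xy$ with $x\in S_i$, $y\in S_j$ whenever $v_iv_j\in E(H)$. For $S\subseteq V(G_i)$, the characteristic vector $\chi_S$ is the $0$-$1$ vector whose entry at a vertex is $1$ iff the vertex lies in $S$. An eigenvalue $\theta$ of a real symmetric matrix $A$ is $u$-main if $u$ is not orthogonal to the eigenspace of $\theta$. *)

theory Defs
  imports
    Graph_Theory.Pair_Digraph
    Jordan_Normal_Form.Char_Poly
    Jordan_Normal_Form.Gauss_Jordan_Elimination
    "HOL-Computational_Algebra.Polynomial_Factorial"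
begin

text \<open>
  Finite simple graphs are the \<^locale>\<open>pair_graph\<close>s (finite, loop-free, symmetric arc set).
  The vertices of the join are tagged with the vertex of \<open>H\<close> they belong to, which makes the union
  of the vertex sets disjoint.
\<close>

definition generalized_join ::
  "'h pair_pre_digraph \<Rightarrow> ('h \<Rightarrow> 'a pair_pre_digraph) \<Rightarrow> ('h \<Rightarrow> 'a set) \<Rightarrow> ('h \<times> 'a) pair_pre_digraph"
where
  "generalized_join H G S =
     \<lparr> pverts = (SIGMA v : pverts H. pverts (G v)),
       parcs = {((v, x), (v, y)) | v x y. v \<in> pverts H \<and> (x, y) \<in> parcs (G v)}
             \<union> {((v, x), (w, y)) | v w x y. (v, w) \<in> parcs H \<and> x \<in> S v \<and> y \<in> S w} \<rparr>"

lemma pair_graph_generalized_join: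
  assumes H: "pair_graph H"
    and G: "\<And>v. v \<in> pverts H \<Longrightarrow> pair_graph (G v)"
    and S: "\<And>v. v \<in> pverts H \<Longrightarrow> S v \<subseteq> pverts (G v)"
  shows "pair_graph (generalized_join H G S)"
proof -
  let ?J = "generalized_join H G S"
  interpret H: pair_graph H by (rule H)
  have finG: "finite (pverts (G v))" if "v \<in> pverts H" for v
    using G[OF that] by (simp add: pair_graph_def pair_digraph_def pair_fin_digraph_def
        pair_fin_digraph_axioms_def)
  have wfG: "x \<in> pverts (G v)" "y \<in> pverts (G v)" "x \<noteq> y" "(y, x) \<in> parcs (G v)"
    if "v \<in> pverts H" "(x, y) \<in> parcs (G v)" for v x y
  proof -
    interpret G: pair_graph "G v" by (rule G[OF that(1)])
    show "x \<in> pverts (G v)" "y \<in> pverts (G v)" using that(2) by (auto dest: G.in_arcsD1 G.in_arcsD2)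
    show "x \<noteq> y" using G.pair_no_loops[OF that(2)] by simp
    show "(y, x) \<in> parcs (G v)"
      using symD[OF G.pair_sym_arcs[unfolded symmetric_def with_proj_simps] that(2)] .
  qed
  have wfH: "v \<in> pverts H" "w \<in> pverts H" "v \<noteq> w" "(w, v) \<in> parcs H" if "(v, w) \<in> parcs H" for v w
    using H.in_arcsD1[OF that] H.in_arcsD2[OF that] H.pair_no_loops[OF that]
      symD[OF H.pair_sym_arcs[unfolded symmetric_def with_proj_simps] that] by simp_all
  have fin: "finite (pverts ?J)"
    using H.pair_finite_verts finG by (simp add: generalized_join_def)
  have arcs: "fst e \<in> pverts ?J \<and> snd e \<in> pverts ?J \<and> fst e \<noteq> snd e \<and> (snd e, fst e) \<in> parcs ?J"
    if e: "e \<in> parcs ?J" for e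
  proof -
    from e consider
        v x y where "e = ((v, x), (v, y))" "v \<in> pverts H" "(x, y) \<in> parcs (G v)"
      | v w x y where "e = ((v, x), (w, y))" "(v, w) \<in> parcs H" "x \<in> S v" "y \<in> S w"
      unfolding generalized_join_def by auto
    then show ?thesis
    proof cases
      case 1
      then show ?thesis using wfG[OF 1(2,3)] by (simp add: generalized_join_def)
    next
      case 2
      then show ?thesis using wfH[OF 2(2)] S[of v] S[of w] by (auto simp: generalized_join_def)
    qed
  qed
  have "parcs ?J \<subseteq> pverts ?J \<times> pverts ?J"
  proof
    fix e assume "e \<in> parcs ?J"
    from arcs[OF this] show "e \<in> pverts ?J \<times> pverts ?J" by (cases e) simp
  qed
  then have finE: "finite (parcs ?J)"
    by (rule finite_subset) (simp add: fin)
  have "sym (parcs ?J)"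
  proof (rule symI)
    fix a b assume "(a, b) \<in> parcs ?J"
    from arcs[OF this] show "(b, a) \<in> parcs ?J" by simp
  qed
  then have symJ: "symmetric ?J" by (simp add: symmetric_def)
  show ?thesis
    by unfold_locales (simp_all add: arcs fin finE symJ del: split_paired_All)
qed

text \<open>
  Matrices and vectors indexed by a vertex set are taken with respect to a list \<open>xs\<close> that
  enumerates the vertices without repetition.
\<close>

definition enumerates :: "'a list \<Rightarrow> 'a set \<Rightarrow> bool" where
  "enumerates xs V \<longleftrightarrow> distinct xs \<and> set xs = V"

definition adjacency_matrix :: "'a pair_pre_digraph \<Rightarrow> 'a list \<Rightarrow> real mat" where
  "adjacency_matrix G xs =
     mat (length xs) (length xs) (\<lambda>(i, j). if (xs ! i, xs ! j) \<in> parcs G then 1 else 0)"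

definition characteristic_vec :: "'a set \<Rightarrow> 'a list \<Rightarrow> real vec" where
  "characteristic_vec S xs = vec (length xs) (\<lambda>i. if xs ! i \<in> S then 1 else 0)"

definition eigenspace :: "'a :: comm_ring_1 mat \<Rightarrow> 'a \<Rightarrow> 'a vec set" where
  "eigenspace A \<theta> = {v \<in> carrier_vec (dim_row A). A *\<^sub>v v = \<theta> \<cdot>\<^sub>v v}"

definition main_eigenvalue :: "real mat \<Rightarrow> real vec \<Rightarrow> real \<Rightarrow> bool" where
  "main_eigenvalue A u \<theta> \<longleftrightarrow> eigenvalue A \<theta> \<and> \<not> (\<forall>v \<in> eigenspace A \<theta>. u \<bullet> v = 0)"

text \<open>
  Expressions involving \<open>(\<lambda> I - A)\<^sup>-\<^sup>1\<close> are rational functions of the indeterminate \<open>\<lambda>\<close>, i.e. elements of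
  the fraction field of \<open>\<real>[\<lambda>]\<close>; \<^const>\<open>char_poly_matrix\<close> is \<open>\<lambda> I - A\<close> over \<open>\<real>[\<lambda>]\<close>.
\<close>

definition resolvent :: "real mat \<Rightarrow> real poly fract mat" where
  "resolvent A = the (mat_inverse (map_mat to_fract (char_poly_matrix A)))"

lemma resolvent_inverse:
  assumes A: "A \<in> carrier_mat n n"
  shows "resolvent A \<in> carrier_mat n n"
    and "map_mat to_fract (char_poly_matrix A) * resolvent A = 1\<^sub>m n"
    and "resolvent A * map_mat to_fract (char_poly_matrix A) = 1\<^sub>m n"
proof -
  interpret to_fract: comm_ring_hom "to_fract :: real poly \<Rightarrow> real poly fract"
    by unfold_locales auto
  let ?M = "map_mat to_fract (char_poly_matrix A)"
  have M: "?M \<in> carrier_mat n n" using A by simp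
  have "char_poly A \<noteq> 0" using degree_monic_char_poly[OF A] by auto
  then have "det ?M \<noteq> 0"
    by (simp add: to_fract.hom_det char_poly_def)
  then have "?M \<in> Units (ring_mat TYPE(real poly fract) n ())"
    by (rule det_non_zero_imp_unit[OF M])
  then obtain B where B: "mat_inverse ?M = Some B"
    using mat_inverse(1)[OF M, where b = "()"] by (cases "mat_inverse ?M") auto
  then show "resolvent A \<in> carrier_mat n n" "?M * resolvent A = 1\<^sub>m n" "resolvent A * ?M = 1\<^sub>m n"
    using mat_inverse(2)[OF M B] by (auto simp: resolvent_def)
qed

definition main_function :: "real mat \<Rightarrow> real vec \<Rightarrow> real poly fract" where
  "main_function A u =
     (let u' = map_vec (\<lambda>c. to_fract [:c:]) u in u' \<bullet> (resolvent A *\<^sub>v u'))"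

definition main_poly :: "real mat \<Rightarrow> real vec \<Rightarrow> real poly" where
  "main_poly A u = (\<Prod>\<theta> | main_eigenvalue A u \<theta>. [:-\<theta>, 1:])"

text \<open>
  Roots are counted in \<open>\<complex>\<close>, so that no root is lost; for a symmetric matrix all of them are real and
  their multiplicities are the dimensions of the eigenspaces.
\<close>

definition complex_roots :: "real poly \<Rightarrow> complex multiset" where
  "complex_roots p = proots (map_poly complex_of_real p)"

definition spectrum_mset :: "real mat \<Rightarrow> complex multiset" where
  "spectrum_mset A = complex_roots (char_poly A)"

definition eigenvalue_mult :: "real mat \<Rightarrow> real \<Rightarrow> nat" where
  "eigenvalue_mult A \<theta> = count (spectrum_mset A) (complex_of_real \<theta>)"

end

theory Submission
  imports Defs Jordan_Normal_Form.Schur_Decomposition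
begin

text \<open>
  Ordering the vertices of the join block by block, \<open>\<lambda>I - A\<^sub>G = D - X Y\<close> with \<open>D\<close> the block diagonal
  matrix of the \<open>\<lambda>I - A\<^sub>i\<close>, \<open>Y\<close> the transpose of the matrix whose columns are the \<open>\<chi>\<close>-vectors and
  \<open>X = Y\<^sup>T \<rho>\<close>. The identity \<open>det (I - P Q) = det (I - Q P)\<close> reduces the determinant to the \<open>k \<times> k\<close>
  determinant of \<open>I - \<Gamma> \<rho>\<close>; scaling its rows by \<open>1/\<Gamma>\<^sub>i\<close> or by \<open>g\<^sub>i\<close> gives the two formulas.

  It remains to see that \<open>f\<^sub>i = g\<^sub>i \<Gamma>\<^sub>i\<close> is a nonzero polynomial. For symmetric \<open>A\<close> the product of the
  \<open>A - \<theta>\<close> over the \<open>u\<close>-main eigenvalues kills \<open>u\<close>, and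
  \<open>(\<lambda> - t) u\<^sup>T (\<lambda> - A)\<^sup>-\<^sup>1 w = u \<bullet> w + u\<^sup>T (\<lambda> - A)\<^sup>-\<^sup>1 (A - t) w\<close> turns this into a polynomial formula
  for \<open>f\<close> with leading coefficient \<open>u \<bullet> u\<close>.
\<close>

subsection \<open>Determinants of matrices indexed by lists\<close>

text \<open>Entries are addressed by list elements rather than positions: products become sums over
  sets, and a change of enumeration becomes a permutation of the list.\<close>

definition indexed_mat :: "'a list \<Rightarrow> 'b list \<Rightarrow> ('a \<Rightarrow> 'b \<Rightarrow> 'c) \<Rightarrow> 'c mat" where
  "indexed_mat xs ys F = mat (length xs) (length ys) (\<lambda>(i, j). F (xs ! i) (ys ! j))"

lemma indexed_mat_carrier [simp]: "indexed_mat xs ys F \<in> carrier_mat (length xs) (length ys)"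
  by (simp add: indexed_mat_def)

lemma indexed_mat_dim [simp]:
  "dim_row (indexed_mat xs ys F) = length xs" "dim_col (indexed_mat xs ys F) = length ys"
  by (simp_all add: indexed_mat_def)

lemma indexed_mat_index [simp]:
  "i < length xs \<Longrightarrow> j < length ys \<Longrightarrow> indexed_mat xs ys F $$ (i, j) = F (xs ! i) (ys ! j)"
  by (simp add: indexed_mat_def)

lemma indexed_mat_cong:
  assumes "\<And>x y. x \<in> set xs \<Longrightarrow> y \<in> set ys \<Longrightarrow> F x y = F' x y"
  shows "indexed_mat xs ys F = indexed_mat xs ys F'"
  by (rule eq_matI) (auto simp: assms)

lemma indexed_mat_map: "indexed_mat (map a xs) (map b ys) F = indexed_mat xs ys (\<lambda>x y. F (a x) (b y))"
  by (rule eq_matI) auto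

lemma indexed_mat_diff:
  "indexed_mat xs ys F - indexed_mat xs ys F' = indexed_mat xs ys (\<lambda>x y. F x y - (F' x y :: 'c :: group_add))"
  by (rule eq_matI) auto

lemma one_mat_indexed: "distinct xs \<Longrightarrow> 1\<^sub>m (length xs) = indexed_mat xs xs (\<lambda>x y. if x = y then 1 else 0)"
  by (rule eq_matI) (auto simp: nth_eq_iff_index_eq)

lemma sum_nth_distinct:
  assumes "distinct ys"
  shows "(\<Sum>i = 0..<length ys. F (ys ! i)) = sum F (set ys)"
proof -
  have "bij_betw ((!) ys) {0..<length ys} (set ys)"
    using bij_betw_nth[OF assms, of "{0..<length ys}" "set ys"] by (simp add: lessThan_atLeast0)
  then show ?thesis by (rule sum.reindex_bij_betw)
qed

lemma indexed_mat_mult: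
  assumes "distinct ys"
  shows "indexed_mat xs ys F * indexed_mat ys ws F' =
    indexed_mat xs ws (\<lambda>x w. \<Sum>y\<in>set ys. F x y * (F' y w :: 'c :: semiring_0))"
proof (rule eq_matI)
  fix i j
  assume "i < dim_row (indexed_mat xs ws (\<lambda>x w. \<Sum>y\<in>set ys. F x y * F' y w))"
    "j < dim_col (indexed_mat xs ws (\<lambda>x w. \<Sum>y\<in>set ys. F x y * F' y w))"
  then show "(indexed_mat xs ys F * indexed_mat ys ws F') $$ (i, j) =
      indexed_mat xs ws (\<lambda>x w. \<Sum>y\<in>set ys. F x y * F' y w) $$ (i, j)"
    using sum_nth_distinct[OF assms, of "\<lambda>y. F (xs ! i) y * F' y (ws ! j)"]
    by (simp add: scalar_prod_def)
qed simp_all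

text \<open>Permuting rows and columns alike contributes the sign twice, and the square of a sign is
  1. The columns are reached by transposing.\<close>

lemma det_permute_rows_columns:
  fixes A :: "'a :: comm_ring_1 mat"
  assumes A: "A \<in> carrier_mat n n" and p: "p permutes {0..<n}"
  shows "det (mat n n (\<lambda>(i, j). A $$ (p i, p j))) = det A"
proof -
  let ?B = "mat n n (\<lambda>(i, j). A $$ (p i, j))"
  have lt: "p i < n" if "i < n" for i
    using permutes_in_image[OF p, of i] that by simp
  have eq: "transpose_mat (mat n n (\<lambda>(i, j). A $$ (p i, p j))) =
      mat n n (\<lambda>(i, j). (transpose_mat ?B) $$ (p i, j))"
    by (rule eq_matI) (auto simp: lt)
  have "det (mat n n (\<lambda>(i, j). A $$ (p i, p j))) =
      det (transpose_mat (mat n n (\<lambda>(i, j). A $$ (p i, p j))))"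
    by (rule det_transpose[symmetric, of _ n]) simp
  also have "\<dots> = signof p * det (transpose_mat ?B)"
    unfolding eq by (rule det_permute_rows[OF _ p]) simp
  also have "det (transpose_mat ?B) = signof p * det A"
    using det_permute_rows[OF A p] det_transpose[of ?B n] by simp
  also have "signof p * (signof p * det A) = (signof p * signof p) * det A"
    by (simp only: mult.assoc)
  also have "signof p * signof p = (1 :: 'a)"
    by (simp add: sign_def)
  finally show ?thesis by simp
qed

text \<open>This allows an arbitrary enumeration of the vertices of the join to be replaced by the
  block by block one.\<close>

lemma det_indexed_mat_reorder:
  fixes F :: "'a \<Rightarrow> 'a \<Rightarrow> 'c :: comm_ring_1"
  assumes "distinct xs" "distinct ys" "set xs = set ys"
  shows "det (indexed_mat xs xs F) = det (indexed_mat ys ys F)"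
proof -
  have "mset xs = mset ys"
    using assms set_eq_iff_mset_eq_distinct by blast
  then obtain p where p: "p permutes {..<length ys}" and xs: "permute_list p ys = xs"
    by (rule mset_eq_permutation)
  have lt: "p i < length ys" if "i < length ys" for i
    using permutes_in_image[OF p, of i] that by simp
  have len: "length xs = length ys" using xs by auto
  have "indexed_mat xs xs F =
      mat (length ys) (length ys) (\<lambda>(i, j). indexed_mat ys ys F $$ (p i, p j))"
    by (rule eq_matI) (auto simp: len lt xs[symmetric] permute_list_nth[OF p])
  then show ?thesis
    using det_permute_rows_columns[of "indexed_mat ys ys F" "length ys" p] p
    by (simp add: lessThan_atLeast0)
qed

lemma det_indexed_mat_append:
  fixes F :: "'a \<Rightarrow> 'a \<Rightarrow> 'c :: idom"
  assumes "\<And>x y. x \<in> set xs \<Longrightarrow> y \<in> set ys \<Longrightarrow> F x y = 0"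
  shows "det (indexed_mat (xs @ ys) (xs @ ys) F) = det (indexed_mat xs xs F) * det (indexed_mat ys ys F)"
proof -
  have "indexed_mat (xs @ ys) (xs @ ys) F =
      four_block_mat (indexed_mat xs xs F) (0\<^sub>m (length xs) (length ys))
        (indexed_mat ys xs F) (indexed_mat ys ys F)"
    by (rule eq_matI) (auto simp: nth_append assms)
  then show ?thesis
    using det_four_block_mat_upper_right_zero[OF indexed_mat_carrier refl indexed_mat_carrier indexed_mat_carrier]
    by simp
qed

lemma det_indexed_mat_concat:
  fixes F :: "'a \<Rightarrow> 'a \<Rightarrow> 'c :: idom"
  assumes "distinct hs"
    and "\<And>v w x y. v \<in> set hs \<Longrightarrow> w \<in> set hs \<Longrightarrow> v \<noteq> w \<Longrightarrow> x \<in> set (ls v) \<Longrightarrow> y \<in> set (ls w) \<Longrightarrow> F x y = 0"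
  shows "det (indexed_mat (concat (map ls hs)) (concat (map ls hs)) F) =
    (\<Prod>v\<in>set hs. det (indexed_mat (ls v) (ls v) F))"
  using assms
proof (induction hs)
  case Nil
  then show ?case by (simp add: indexed_mat_def)
next
  case (Cons h hs)
  have "det (indexed_mat (concat (map ls (h # hs))) (concat (map ls (h # hs))) F) =
      det (indexed_mat (ls h) (ls h) F) *
      det (indexed_mat (concat (map ls hs)) (concat (map ls hs)) F)"
    using Cons.prems by (fastforce simp: intro!: det_indexed_mat_append)
  also have "det (indexed_mat (concat (map ls hs)) (concat (map ls hs)) F) =
      (\<Prod>v\<in>set hs. det (indexed_mat (ls v) (ls v) F))"
    using Cons.prems by (intro Cons.IH) auto
  finally show ?case using Cons.prems(1) by simp
qed

text \<open>Sylvester's determinant identity. Both sides equal \<open>det ?M\<close>: right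
  multiplication by the unipotent matrix \<open>?R\<close> clears the block \<open>Q\<close>, by
  \<open>?R'\<close> the block \<open>P\<close>, and each time the Schur complement of an identity
  block remains.\<close>

lemma det_one_minus_mult_commute:
  fixes P :: "'a :: idom mat"
  assumes P: "P \<in> carrier_mat n k" and Q: "Q \<in> carrier_mat k n"
  shows "det (1\<^sub>m n - P * Q) = det (1\<^sub>m k - Q * P)"
proof -
  let ?M = "four_block_mat (1\<^sub>m n) P Q (1\<^sub>m k)"
  let ?R = "four_block_mat (1\<^sub>m n) (0\<^sub>m n k) (- Q) (1\<^sub>m k)"
  let ?R' = "four_block_mat (1\<^sub>m n) (- P) (0\<^sub>m k n) (1\<^sub>m k)"
  have M: "?M \<in> carrier_mat (n + k) (n + k)" by simp
  have PQ: "P * Q \<in> carrier_mat n n" "Q * P \<in> carrier_mat k k" using P Q by auto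
  have R: "?R \<in> carrier_mat (n + k) (n + k)" "?R' \<in> carrier_mat (n + k) (n + k)" by simp_all
  have "?M * ?R = four_block_mat (1\<^sub>m n * 1\<^sub>m n + P * (- Q)) (1\<^sub>m n * 0\<^sub>m n k + P * 1\<^sub>m k)
      (Q * 1\<^sub>m n + 1\<^sub>m k * (- Q)) (Q * 0\<^sub>m n k + 1\<^sub>m k * 1\<^sub>m k)"
    using P Q by (intro mult_four_block_mat) auto
  also have "\<dots> = four_block_mat (1\<^sub>m n - P * Q) P (0\<^sub>m k n) (1\<^sub>m k)"
    using P Q PQ by (intro arg_cong4[where f = four_block_mat]) (auto intro!: eq_matI)
  finally have MR: "?M * ?R = four_block_mat (1\<^sub>m n - P * Q) P (0\<^sub>m k n) (1\<^sub>m k)" .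
  have "?M * ?R' = four_block_mat (1\<^sub>m n * 1\<^sub>m n + P * 0\<^sub>m k n) (1\<^sub>m n * (- P) + P * 1\<^sub>m k)
      (Q * 1\<^sub>m n + 1\<^sub>m k * 0\<^sub>m k n) (Q * (- P) + 1\<^sub>m k * 1\<^sub>m k)"
    using P Q by (intro mult_four_block_mat) auto
  also have "\<dots> = four_block_mat (1\<^sub>m n) (0\<^sub>m n k) Q (1\<^sub>m k - Q * P)"
    using P Q PQ by (intro arg_cong4[where f = four_block_mat]) (auto intro!: eq_matI)
  finally have MR': "?M * ?R' = four_block_mat (1\<^sub>m n) (0\<^sub>m n k) Q (1\<^sub>m k - Q * P)" .
  have "det ?R = 1"
    using det_four_block_mat_upper_right_zero[of "1\<^sub>m n :: 'a mat" n "0\<^sub>m n k" k "- Q" "1\<^sub>m k"] Q by simp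
  moreover have "det ?R' = 1"
    using det_four_block_mat_lower_left_zero[of "1\<^sub>m n :: 'a mat" n "- P" k "0\<^sub>m k n" "1\<^sub>m k"] P by simp
  moreover have "det (?M * ?R) = det (1\<^sub>m n - P * Q)"
    unfolding MR using det_four_block_mat_lower_left_zero[of "1\<^sub>m n - P * Q" n P k "0\<^sub>m k n" "1\<^sub>m k"] P PQ
    by (simp add: minus_carrier_mat)
  moreover have "det (?M * ?R') = det (1\<^sub>m k - Q * P)"
    unfolding MR' using det_four_block_mat_upper_right_zero[of "1\<^sub>m n :: 'a mat" n "0\<^sub>m n k" k Q "1\<^sub>m k - Q * P"] Q PQ
    by (simp add: minus_carrier_mat)
  ultimately show ?thesis
    using det_mult[OF M R(1)] det_mult[OF M R(2)] by simp
qed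

text \<open>Factoring out \<open>D\<close> gives \<open>D - X * Y = D * (1 - (E * X) * Y)\<close>;
  Sylvester's identity then shrinks the second factor from size \<open>n\<close> to size
  \<open>k\<close>.\<close>

lemma det_minus_mult:
  fixes D :: "'a :: idom mat"
  assumes D: "D \<in> carrier_mat n n" and E: "E \<in> carrier_mat n n" and DE: "D * E = 1\<^sub>m n"
    and X: "X \<in> carrier_mat n k" and Y: "Y \<in> carrier_mat k n"
  shows "det (D - X * Y) = det D * det (1\<^sub>m k - Y * (E * X))"
proof -
  have "D * (1\<^sub>m n - (E * X) * Y) = D * 1\<^sub>m n - D * ((E * X) * Y)"
    using D E X Y by (intro mult_minus_distrib_mat) auto
  also have "D * ((E * X) * Y) = (D * (E * X)) * Y"
    using D E X Y by (intro assoc_mult_mat[symmetric]) auto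
  also have "D * (E * X) = X"
    using D E X DE by (simp add: assoc_mult_mat[symmetric, of D n n E n X k])
  finally have "D - X * Y = D * (1\<^sub>m n - (E * X) * Y)" using D by simp
  then have "det (D - X * Y) = det D * det (1\<^sub>m n - (E * X) * Y)"
    using det_mult[of D n "1\<^sub>m n - (E * X) * Y"] D E X Y by (simp add: minus_carrier_mat)
  also have "det (1\<^sub>m n - (E * X) * Y) = det (1\<^sub>m k - Y * (E * X))"
    using E X Y by (intro det_one_minus_mult_commute) auto
  finally show ?thesis .
qed

subsection \<open>Main eigenvalues of symmetric matrices\<close>

text \<open>Products of factors \<open>A - t\<close> are only ever applied to vectors, so they are
  iterated as maps on vectors and no matrix polynomial is formed.\<close>

definition shift_mult :: "'a :: field mat \<Rightarrow> 'a \<Rightarrow> 'a vec \<Rightarrow> 'a vec" where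
  "shift_mult A t v = A *\<^sub>v v - t \<cdot>\<^sub>v v"

abbreviation shifts_mult :: "'a :: field mat \<Rightarrow> 'a list \<Rightarrow> 'a vec \<Rightarrow> 'a vec" where
  "shifts_mult A \<equiv> foldr (shift_mult A)"

lemma shift_mult_carrier [simp]:
  "A \<in> carrier_mat n n \<Longrightarrow> v \<in> carrier_vec n \<Longrightarrow> shift_mult A t v \<in> carrier_vec n"
  by (simp add: shift_mult_def minus_carrier_vec)

lemma shifts_mult_carrier [simp]:
  "A \<in> carrier_mat n n \<Longrightarrow> v \<in> carrier_vec n \<Longrightarrow> shifts_mult A ts v \<in> carrier_vec n"
  by (induction ts) simp_all

lemma shift_mult_commute:
  assumes A: "A \<in> carrier_mat n n" and v: "v \<in> carrier_vec n"
  shows "shift_mult A s (shift_mult A t v) = shift_mult A t (shift_mult A s v)"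
proof -
  have "A *\<^sub>v (A *\<^sub>v v - r \<cdot>\<^sub>v v) = A *\<^sub>v (A *\<^sub>v v) - r \<cdot>\<^sub>v (A *\<^sub>v v)" for r
    using A v by (subst mult_minus_distrib_mat_vec[of _ n n]) (auto simp: mult_mat_vec)
  then show ?thesis
    unfolding shift_mult_def using A v by (intro eq_vecI) (auto simp: algebra_simps)
qed

lemma shifts_mult_shift_commute:
  assumes "A \<in> carrier_mat n n" "v \<in> carrier_vec n"
  shows "shifts_mult A ts (shift_mult A t v) = shift_mult A t (shifts_mult A ts v)"
  using assms by (induction ts) (simp_all add: shift_mult_commute[of A n _ _ t])

lemma shift_mult_zero: "A \<in> carrier_mat n n \<Longrightarrow> shift_mult A t (0\<^sub>v n) = 0\<^sub>v n"
  by (intro eq_vecI) (auto simp: shift_mult_def)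

lemma shifts_mult_zero: "A \<in> carrier_mat n n \<Longrightarrow> shifts_mult A ts (0\<^sub>v n) = 0\<^sub>v n"
  by (induction ts) (simp_all add: shift_mult_zero)

lemma shift_mult_eq_0_iff:
  assumes "A \<in> carrier_mat n n" "v \<in> carrier_vec n"
  shows "shift_mult A t v = 0\<^sub>v n \<longleftrightarrow> v \<in> eigenspace A t"
proof -
  have "A *\<^sub>v v = t \<cdot>\<^sub>v v" if "A *\<^sub>v v - t \<cdot>\<^sub>v v = 0\<^sub>v n"
  proof (rule eq_vecI)
    fix i assume i: "i < dim_vec (t \<cdot>\<^sub>v v)"
    have "(A *\<^sub>v v - t \<cdot>\<^sub>v v) $ i = 0" using i that assms by simp
    then show "(A *\<^sub>v v) $ i = (t \<cdot>\<^sub>v v) $ i" using i assms by simp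
  qed (use assms in auto)
  then show ?thesis using assms by (auto simp: eigenspace_def shift_mult_def)
qed

lemma shifts_mult_eigenspace:
  assumes "A \<in> carrier_mat n n" "v \<in> eigenspace A \<theta>"
  shows "shifts_mult A ts v = (\<Prod>t\<leftarrow>ts. \<theta> - t) \<cdot>\<^sub>v v"
proof (induction ts)
  case (Cons t ts)
  have "A *\<^sub>v v = \<theta> \<cdot>\<^sub>v v" "v \<in> carrier_vec n"
    using assms by (auto simp: eigenspace_def)
  then have "shift_mult A t (c \<cdot>\<^sub>v v) = ((\<theta> - t) * c) \<cdot>\<^sub>v v" for c
    using assms(1) unfolding shift_mult_def
    by (intro eq_vecI) (auto simp: mult_mat_vec algebra_simps)
  then show ?case using Cons by simp
qed (use assms in auto)

lemma shift_mult_symmetric: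
  assumes A: "A \<in> carrier_mat n n" and sym: "transpose_mat A = A"
    and u: "u \<in> carrier_vec n" and v: "v \<in> carrier_vec n"
  shows "u \<bullet> shift_mult A t v = shift_mult A t u \<bullet> v"
proof -
  have "u \<bullet> (A *\<^sub>v v) = (A *\<^sub>v u) \<bullet> v"
    using transpose_vec_mult_scalar[OF A v u] sym by simp
  then show ?thesis using A u v unfolding shift_mult_def
    by (subst scalar_prod_minus_distrib[of _ n], simp_all,
        subst minus_scalar_prod_distrib[of _ n], simp_all)
qed

lemma shifts_mult_symmetric:
  assumes A: "A \<in> carrier_mat n n" and sym: "transpose_mat A = A"
    and u: "u \<in> carrier_vec n" and v: "v \<in> carrier_vec n"
  shows "u \<bullet> shifts_mult A ts v = shifts_mult A ts u \<bullet> v"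
  using u
proof (induction ts arbitrary: u)
  case (Cons t ts)
  have "u \<bullet> shifts_mult A (t # ts) v = shifts_mult A ts (shift_mult A t u) \<bullet> v"
    using Cons A v by (simp add: shift_mult_symmetric[OF A sym])
  then show ?case using Cons.prems A by (simp add: shifts_mult_shift_commute)
qed simp

text \<open>Cayley-Hamilton for triangular matrices. If the entries of \<open>v\<close> vanish
  beyond index \<open>k\<close>, then \<open>B - B $$ (k, k)\<close> also kills entry
  \<open>k\<close>; applying the factors from the last diagonal entry down to the first leaves
  nothing.\<close>

lemma upper_triangular_annihilated:
  assumes B: "B \<in> carrier_mat n n" and tri: "upper_triangular B"
    and "v \<in> carrier_vec n" "k \<le> n" "\<And>i. k \<le> i \<Longrightarrow> i < n \<Longrightarrow> v $ i = 0"
  shows "shifts_mult B (map (\<lambda>i. B $$ (i, i)) [0..<k]) v = 0\<^sub>v n"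
  using assms(3-)
proof (induction k arbitrary: v)
  case 0
  then show ?case by (intro eq_vecI) auto
next
  case (Suc k)
  have "shift_mult B (B $$ (k, k)) v $ i = 0" if i: "k \<le> i" "i < n" for i
  proof -
    have "(B *\<^sub>v v) $ i = (\<Sum>j = 0..<n. B $$ (i, j) * v $ j)"
      using i B Suc.prems by (simp add: scalar_prod_def)
    \<comment> \<open>Columns left of \<open>k\<close> vanish in row \<open>i\<close> because
      \<open>B\<close> is triangular and \<open>j < k \<le> i\<close>; columns right of
      \<open>k\<close> meet zero entries of \<open>v\<close>.\<close>
    also have "\<dots> = (\<Sum>j\<in>{k}. B $$ (i, j) * v $ j)"
    proof (rule sum.mono_neutral_right)
      show "\<forall>j\<in>{0..<n} - {k}. B $$ (i, j) * v $ j = 0"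
      proof
        fix j assume j: "j \<in> {0..<n} - {k}"
        show "B $$ (i, j) * v $ j = 0"
          using j i Suc.prems(3)[of j] upper_triangularD[OF tri, of j i] B
          by (cases "j < k") auto
      qed
    qed (use Suc.prems in auto)
    \<comment> \<open>For \<open>i = k\<close> this is the remaining term; for \<open>i > k\<close>
      both sides are 0.\<close>
    also have "\<dots> = B $$ (k, k) * v $ i"
      using i Suc.prems(3)[of i] upper_triangularD[OF tri, of k i] B by (cases "i = k") auto
    finally show ?thesis using i B Suc.prems by (simp add: shift_mult_def)
  qed
  then show ?case using Suc.IH[of "shift_mult B (B $$ (k, k)) v"] B Suc.prems by simp
qed

text \<open>From \<open>A * P = P * B\<close> each shift of \<open>A\<close> passes through
  \<open>P\<close> and becomes the same shift of \<open>B\<close>.\<close>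

lemma shifts_mult_similar:
  assumes sim: "similar_mat_wit A B P Q" and A: "A \<in> carrier_mat n n" and v: "v \<in> carrier_vec n"
  shows "shifts_mult A ts v = P *\<^sub>v shifts_mult B ts (Q *\<^sub>v v)"
proof -
  note wit = similar_mat_witD2[OF A sim]
  have AP: "A * P = P * B"
  proof -
    have "A * P = P * B * (Q * P)"
      using wit by (simp add: assoc_mult_mat[of _ n n _ n _ n])
    then show ?thesis using wit by simp
  qed
  have step: "shift_mult A t (P *\<^sub>v w) = P *\<^sub>v shift_mult B t w" if w: "w \<in> carrier_vec n" for t w
  proof -
    have "A *\<^sub>v (P *\<^sub>v w) = P *\<^sub>v (B *\<^sub>v w)"
      using wit w AP by (metis assoc_mult_mat_vec)
    moreover have "P *\<^sub>v (B *\<^sub>v w - t \<cdot>\<^sub>v w) = P *\<^sub>v (B *\<^sub>v w) - t \<cdot>\<^sub>v (P *\<^sub>v w)"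
      using wit w by (subst mult_minus_distrib_mat_vec[of _ n n]) (auto simp: mult_mat_vec)
    ultimately show ?thesis by (simp add: shift_mult_def)
  qed
  show ?thesis
  proof (induction ts)
    case Nil
    show ?case using wit v assoc_mult_mat_vec[of P n n Q n v] by simp
  next
    case (Cons t ts)
    then show ?case using wit(5-7) v by (simp add: step)
  qed
qed

text \<open>Schur triangularization reduces the claim to the triangular case; the diagonal of the
  triangular matrix serves as the list.\<close>

lemma split_char_poly_annihilates:
  fixes A :: "'a :: conjugatable_ordered_field mat"
  assumes A: "A \<in> carrier_mat n n" and "char_poly A = (\<Prod>a\<leftarrow>es. [:- a, 1:])"
  shows "\<exists>ts. \<forall>v \<in> carrier_vec n. shifts_mult A ts v = 0\<^sub>v n"
proof -
  obtain B P Q where B: "B \<in> carrier_mat n n" "upper_triangular B" and sim: "similar_mat_wit A B P Q"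
    using schur_decomposition_exists[OF assms] by (auto simp: similar_mat_def)
  note wit = similar_mat_witD2[OF A sim]
  \<comment> \<open>With \<open>k = n\<close> no entry of \<open>Q *\<^sub>v v\<close> has to
    vanish, so the triangular case applies to every vector.\<close>
  have "shifts_mult A (map (\<lambda>i. B $$ (i, i)) [0..<n]) v = 0\<^sub>v n" if "v \<in> carrier_vec n" for v
    using that wit upper_triangular_annihilated[OF B, of "Q *\<^sub>v v" n]
    by (subst shifts_mult_similar[OF sim A]) auto
  then show ?thesis by blast
qed

text \<open>The characteristic polynomial splits over the complex numbers. For a root
  \<open>a\<close> with eigenvector \<open>v\<close>, symmetry moves the matrix across the product
  of \<open>conjugate v\<close> and \<open>v\<close> and gives \<open>cnj a = a\<close>, so the
  factorization already lives over the reals.\<close>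

lemma symmetric_char_poly_splits:
  fixes A :: "real mat"
  assumes A: "A \<in> carrier_mat n n" and sym: "transpose_mat A = A"
  shows "\<exists>es. char_poly A = (\<Prod>a\<leftarrow>es. [:- a, 1:])"
proof -
  let ?C = "map_mat complex_of_real A"
  have C: "?C \<in> carrier_mat n n" using A by simp
  interpret poly: map_poly_inj_comm_ring_hom complex_of_real ..
  obtain as where as: "char_poly ?C = (\<Prod>a\<leftarrow>as. [:- a, 1:])"
    using char_poly_factorized[OF C] by auto
  have real: "complex_of_real (Re a) = a" if "a \<in> set as" for a
  proof -
    have "poly (char_poly ?C) a = 0"
      using that unfolding as by (induction as) auto
    then obtain v where v: "v \<in> carrier_vec n" "v \<noteq> 0\<^sub>v n" "?C *\<^sub>v v = a \<cdot>\<^sub>v v"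
      using eigenvalue_root_char_poly[OF C] A by (auto simp: eigenvalue_def eigenvector_def)
    have cv: "conjugate v \<in> carrier_vec n" using v by simp
    \<comment> \<open>The entries of \<open>?C\<close> are real, so conjugation passes through it
      and \<open>conjugate v\<close> is an eigenvector for \<open>cnj a\<close>.\<close>
    have "conjugate (?C *\<^sub>v v) = ?C *\<^sub>v conjugate v"
      using A v(1) by (intro eq_vecI) (auto simp: scalar_prod_def)
    then have "?C *\<^sub>v conjugate v = cnj a \<cdot>\<^sub>v conjugate v"
      using v by (simp add: conjugate_smult_vec)
    moreover have "transpose_mat ?C = ?C"
      using sym by (metis map_mat_transpose)
    then have "(?C *\<^sub>v conjugate v) \<bullet> v = conjugate v \<bullet> (?C *\<^sub>v v)"
      using transpose_vec_mult_scalar[OF C v(1) cv] by simp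
    ultimately have "cnj a * (conjugate v \<bullet> v) = a * (conjugate v \<bullet> v)"
      using v by simp
    moreover have "conjugate v \<bullet> v \<noteq> 0"
      using v conjugate_square_eq_0_vec[OF v(1)] conjugate_vec_sprod_comm[OF v(1) v(1)] by simp
    ultimately have "cnj a = a" by simp
    then show ?thesis by (simp add: complex_eq_iff)
  qed
  have "map_poly complex_of_real (\<Prod>a\<leftarrow>map Re as. [:- a, 1:]) = (\<Prod>a\<leftarrow>as. [:- a, 1:])"
    using real by (induction as) (auto simp: map_poly_pCons poly.hom_mult simp del: mult_pCons_left)
  also have "\<dots> = map_poly complex_of_real (char_poly A)"
    unfolding as[symmetric] by (rule of_real_hom.char_poly_hom[OF A])
  finally have "char_poly A = (\<Prod>a\<leftarrow>map Re as. [:- a, 1:])" by simp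
  then show ?thesis by blast
qed

section \<open>Annihilation by the main eigenvalues\<close>

lemma scalar_prod_self_eq_0:
  fixes v :: "real vec"
  assumes "v \<in> carrier_vec n" "v \<bullet> v = 0"
  shows "v = 0\<^sub>v n"
proof -
  have "conjugate v = v" by (intro eq_vecI) auto
  then show ?thesis using conjugate_square_eq_0_vec[OF assms(1)] assms(2) by simp
qed

lemma finite_eigenvalues:
  fixes A :: "'a :: field mat"
  assumes A: "A \<in> carrier_mat n n"
  shows "finite {\<theta>. eigenvalue A \<theta>}"
proof -
  have "char_poly A \<noteq> 0" using degree_monic_char_poly[OF A] by auto
  then show ?thesis using poly_roots_finite by (simp add: eigenvalue_root_char_poly[OF A])
qed

text \<open>
  Let \<open>t\<close> be a superfluous factor and \<open>z\<close> the result of the other factors, so \<open>A z = t z\<close>. If \<open>t\<close> occurs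
  twice, then \<open>z = (A - t) w\<close> and \<open>z \<bullet> z = w \<bullet> (A - t) z = 0\<close>; if \<open>t\<close> is not main, then \<open>z \<bullet> z\<close> is a
  multiple of \<open>u \<bullet> z = 0\<close>. Either way \<open>t\<close> can be dropped.
\<close>

lemma main_eigenvalues_annihilate:
  assumes A: "A \<in> carrier_mat n n" and sym: "transpose_mat A = A" and u: "u \<in> carrier_vec n"
    and main: "\<And>\<theta>. main_eigenvalue A u \<theta> \<Longrightarrow> \<theta> \<in> set ms"
  shows "shifts_mult A ms u = 0\<^sub>v n"
proof -
  have reduce: "shifts_mult A (ms @ ts) u = 0\<^sub>v n \<Longrightarrow> shifts_mult A ms u = 0\<^sub>v n" for ts
  proof (induction ts)
    case (Cons t ts)
    define z where "z = shifts_mult A (ms @ ts) u"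
    have z: "z \<in> carrier_vec n" using A u by (simp add: z_def)
    have "shift_mult A t z = 0\<^sub>v n"
      using Cons.prems A u unfolding z_def
      by (simp add: shifts_mult_shift_commute[OF A])
    then have ez: "z \<in> eigenspace A t" using A z by (simp add: shift_mult_eq_0_iff)
    have "z \<bullet> z = 0"
    proof (cases "t \<in> set ms")
      case True
      then obtain as bs where ms: "ms = as @ t # bs" by (auto dest: split_list)
      let ?w = "shifts_mult A (as @ bs @ ts) u"
      have w: "?w \<in> carrier_vec n" using A u by (intro shifts_mult_carrier)
      have "z = shift_mult A t ?w"
        unfolding z_def ms using A u by (simp add: shifts_mult_shift_commute[OF A])
      then have "z \<bullet> z = ?w \<bullet> shift_mult A t z"
        using shift_mult_symmetric[OF A sym w z] by simp
      then show ?thesis using \<open>shift_mult A t z = 0\<^sub>v n\<close> w by simp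
    next
      case False
      have "u \<bullet> z = 0"
      proof (cases "z = 0\<^sub>v n")
        case False
        then have "eigenvalue A t"
          using ez A z by (auto simp: eigenvalue_def eigenvector_def eigenspace_def)
        then show ?thesis using main[of t] \<open>t \<notin> set ms\<close> ez by (auto simp: main_eigenvalue_def)
      qed (use u in simp)
      have "z \<bullet> z = u \<bullet> shifts_mult A (ms @ ts) z"
        unfolding shifts_mult_symmetric[OF A sym u z] by (simp add: z_def)
      then show ?thesis
        using shifts_mult_eigenspace[OF A ez, of "ms @ ts"] \<open>u \<bullet> z = 0\<close> u z by simp
    qed
    then show ?case using Cons.IH scalar_prod_self_eq_0[OF z] by (simp add: z_def)
  qed simp
  \<comment> \<open>Some list kills every vector; prefixing it with \<open>ms\<close> keeps the
    result zero, and \<open>reduce\<close> then strips the added factors one by one.\<close>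
  obtain ts where "shifts_mult A ts u = 0\<^sub>v n"
    using symmetric_char_poly_splits[OF A sym] split_char_poly_annihilates[OF A] u by blast
  then show ?thesis using reduce[of ts] shifts_mult_zero[OF A, of ms] by simp
qed

subsection \<open>The resolvent form\<close>

lemma to_fract_char_poly_matrix_index:
  fixes A :: "real mat"
  assumes "A \<in> carrier_mat n n" "i < n" "j < n"
  shows "to_fract (char_poly_matrix A $$ (i, j)) =
    (if i = j then to_fract [:0, 1:] else 0) - to_fract [:A $$ (i, j):]"
proof -
  have "char_poly_matrix A $$ (i, j) = (if i = j then [:0, 1:] else 0) - [:A $$ (i, j):]"
    using assms by (auto simp: char_poly_matrix_def)
  then show ?thesis by (simp only: to_fract_diff if_distrib[of to_fract] to_fract_0)
qed

text \<open>
  The embedding of constants is a variable with a defining assumption, so that the simplifier does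
  not rewrite the constant polynomials.
\<close>

context
  fixes A :: "real mat" and n :: nat and emb :: "real \<Rightarrow> real poly fract"
  assumes A: "A \<in> carrier_mat n n" and emb: "emb = (\<lambda>c. to_fract [:c:])"
begin

interpretation emb: comm_ring_hom emb
  unfolding emb by unfold_locales (simp_all add: pCons_one flip: to_fract_add to_fract_mult)

text \<open>Apply the resolvent to \<open>(\<lambda> - A) w = \<lambda> w - A w\<close> and solve
  for the term with \<open>\<lambda>\<close>.\<close>

lemma resolvent_mult_emb:
  assumes w: "w \<in> carrier_vec n"
  shows "to_fract [:0, 1:] \<cdot>\<^sub>v (resolvent A *\<^sub>v map_vec emb w) =
    map_vec emb w + resolvent A *\<^sub>v map_vec emb (A *\<^sub>v w)"
proof -
  let ?x = "to_fract [:0, 1:] :: real poly fract" and ?w = "map_vec emb w"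
  let ?M = "map_mat to_fract (char_poly_matrix A)"
  note R = resolvent_inverse[OF A]
  have w': "?w \<in> carrier_vec n" "A *\<^sub>v w \<in> carrier_vec n" using A w by auto
  have M: "?M = ?x \<cdot>\<^sub>m 1\<^sub>m n - map_mat emb A"
    using A by (intro eq_matI)
      (auto simp: to_fract_char_poly_matrix_index[OF A] carrier_matD[OF char_poly_matrix_closed[OF A]] emb)
  have Aw: "map_mat emb A *\<^sub>v ?w = map_vec emb (A *\<^sub>v w)"
    using A w by (simp add: emb.mult_mat_vec_hom)
  have "?M *\<^sub>v ?w = ?x \<cdot>\<^sub>v ?w - map_vec emb (A *\<^sub>v w)"
    unfolding M using A w' by (subst minus_mult_distrib_mat_vec[of _ n n]) (auto simp: Aw)
  note Mw = this
  have "?M \<in> carrier_mat n n" using A by simp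
  then have "resolvent A *\<^sub>v (?M *\<^sub>v ?w) = (resolvent A * ?M) *\<^sub>v ?w"
    using R(1) w' by (intro assoc_mult_mat_vec[symmetric])
  then have "?w = resolvent A *\<^sub>v (?x \<cdot>\<^sub>v ?w - map_vec emb (A *\<^sub>v w))"
    using w' unfolding R(3) Mw by simp
  also have "\<dots> = ?x \<cdot>\<^sub>v (resolvent A *\<^sub>v ?w) - resolvent A *\<^sub>v map_vec emb (A *\<^sub>v w)"
    using R(1) w' by (subst mult_minus_distrib_mat_vec[of _ n n]) (auto simp: mult_mat_vec)
  finally have eq: "?w = ?x \<cdot>\<^sub>v (resolvent A *\<^sub>v ?w) - resolvent A *\<^sub>v map_vec emb (A *\<^sub>v w)" .
  show ?thesis
  proof (rule eq_vecI)
    fix i assume "i < dim_vec (?w + resolvent A *\<^sub>v map_vec emb (A *\<^sub>v w))"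
    then have i: "i < n" using R(1) by simp
    then show "(?x \<cdot>\<^sub>v (resolvent A *\<^sub>v ?w)) $ i = (?w + resolvent A *\<^sub>v map_vec emb (A *\<^sub>v w)) $ i"
      using arg_cong[OF eq, of "\<lambda>v. v $ i"] R(1) w' by simp
  qed (use R(1) w in simp)
qed

text \<open>The main function is the case \<open>u = w\<close>. A separate second argument is
  carried because the recursion shifts only that one.\<close>

definition resolvent_form :: "real vec \<Rightarrow> real vec \<Rightarrow> real poly fract" where
  "resolvent_form u w = map_vec emb u \<bullet> (resolvent A *\<^sub>v map_vec emb w)"

text \<open>Pair the identity for \<open>\<lambda>\<close> times the resolvent with
  \<open>u\<close>, then subtract \<open>t\<close> times the form.\<close>

lemma resolvent_form_shift:
  assumes u: "u \<in> carrier_vec n" and w: "w \<in> carrier_vec n"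
  shows "to_fract [:- t, 1:] * resolvent_form u w = to_fract [:u \<bullet> w:] + resolvent_form u (shift_mult A t w)"
proof -
  let ?x = "to_fract [:0, 1:] :: real poly fract" and ?R = "resolvent A" and ?u = "map_vec emb u" and ?w = "map_vec emb w"
  note R = resolvent_inverse[OF A]
  have uw: "?u \<in> carrier_vec n" "?w \<in> carrier_vec n" "map_vec emb (A *\<^sub>v w) \<in> carrier_vec n"
    using A u w by auto
  have "?x * resolvent_form u w = ?u \<bullet> (?x \<cdot>\<^sub>v (?R *\<^sub>v ?w))"
    using R(1) u by (simp add: resolvent_form_def)
  also have "\<dots> = ?u \<bullet> ?w + ?u \<bullet> (?R *\<^sub>v map_vec emb (A *\<^sub>v w))"
    unfolding resolvent_mult_emb[OF w] using R(1) uw by (intro scalar_prod_add_distrib) auto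
  finally have 1: "?x * resolvent_form u w = ?u \<bullet> ?w + resolvent_form u (A *\<^sub>v w)"
    by (simp add: resolvent_form_def)
  have "map_vec emb (shift_mult A t w) = map_vec emb (A *\<^sub>v w) - emb t \<cdot>\<^sub>v ?w"
    using A w by (intro eq_vecI) (auto simp: shift_mult_def emb.hom_minus emb.hom_mult)
  then have "?R *\<^sub>v map_vec emb (shift_mult A t w) = ?R *\<^sub>v map_vec emb (A *\<^sub>v w) - emb t \<cdot>\<^sub>v (?R *\<^sub>v ?w)"
    using R(1) uw by (simp add: mult_minus_distrib_mat_vec[of _ n n] mult_mat_vec)
  then have 2: "resolvent_form u (shift_mult A t w) = resolvent_form u (A *\<^sub>v w) - emb t * resolvent_form u w"
    using R(1) uw unfolding resolvent_form_def
    by (simp add: scalar_prod_minus_distrib[of _ n])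
  have 3: "?u \<bullet> ?w = to_fract [:u \<bullet> w:]"
    using u w emb.hom_sum[of "\<lambda>i. u $ i * w $ i" "{0..<n}"]
    by (simp add: scalar_prod_def emb.hom_mult) (simp add: emb)
  have "to_fract [:- t, 1:] = ?x - emb t"
    by (simp add: emb flip: to_fract_diff)
  then have "to_fract [:- t, 1:] * resolvent_form u w = ?x * resolvent_form u w - emb t * resolvent_form u w"
    by (simp only: left_diff_distrib)
  then show ?thesis using 1 2 3 by simp
qed

text \<open>Iterating the one-step recursion collects the constants into a polynomial
  \<open>r\<close>. The coefficient clauses say that \<open>r\<close> has degree below
  \<open>length ts\<close> and top coefficient \<open>u \<bullet> u\<close>, which later shows
  \<open>r \<noteq> 0\<close>. The guard excludes the empty list, where \<open>r = 0\<close> and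
  \<open>length ts - 1\<close> is truncated.\<close>

lemma resolvent_form_shifts:
  assumes u: "u \<in> carrier_vec n"
  shows "\<exists>r. to_fract (\<Prod>t\<leftarrow>ts. [:- t, 1:]) * resolvent_form u u =
      to_fract r + resolvent_form u (shifts_mult A ts u) \<and>
    (\<forall>i. length ts \<le> i \<longrightarrow> coeff r i = 0) \<and> (ts \<noteq> [] \<longrightarrow> coeff r (length ts - 1) = u \<bullet> u)"
proof (induction ts)
  case Nil
  show ?case by (intro exI[of _ 0]) simp
next
  case (Cons t ts)
  then obtain r where eq: "to_fract (\<Prod>t\<leftarrow>ts. [:- t, 1:]) * resolvent_form u u =
      to_fract r + resolvent_form u (shifts_mult A ts u)"
    and deg: "\<And>i. length ts \<le> i \<Longrightarrow> coeff r i = 0"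
    and lead: "ts \<noteq> [] \<Longrightarrow> coeff r (length ts - 1) = u \<bullet> u"
    by blast
  let ?w = "shifts_mult A ts u"
  \<comment> \<open>A Horner step: the old remainder is multiplied by the new factor and the new
    constant is added.\<close>
  let ?r = "[:- t, 1:] * r + [:u \<bullet> ?w:]"
  have "to_fract (\<Prod>t\<leftarrow>t # ts. [:- t, 1:]) * resolvent_form u u =
      to_fract [:- t, 1:] * (to_fract r + resolvent_form u ?w)"
    unfolding list.map prod_list.Cons to_fract_mult mult.assoc eq ..
  also have "\<dots> = to_fract ([:- t, 1:] * r) + to_fract [:- t, 1:] * resolvent_form u ?w"
    by (simp only: distrib_left to_fract_mult)
  also have "to_fract [:- t, 1:] * resolvent_form u ?w =
      to_fract [:u \<bullet> ?w:] + resolvent_form u (shifts_mult A (t # ts) u)"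
    using resolvent_form_shift[OF u, of ?w t] A u by simp
  also have "to_fract ([:- t, 1:] * r) + (to_fract [:u \<bullet> ?w:] + resolvent_form u (shifts_mult A (t # ts) u)) =
      to_fract ?r + resolvent_form u (shifts_mult A (t # ts) u)"
    by (simp only: to_fract_add add.assoc)
  finally have "to_fract (\<Prod>t\<leftarrow>t # ts. [:- t, 1:]) * resolvent_form u u =
      to_fract ?r + resolvent_form u (shifts_mult A (t # ts) u)" .
  moreover have "coeff ?r i = 0" if "length (t # ts) \<le> i" for i
    using that deg[of i] deg[of "i - 1"] by (auto simp: coeff_pCons split: nat.splits)
  moreover have "coeff ?r (length (t # ts) - 1) = u \<bullet> u"
  proof (cases ts)
    \<comment> \<open>The first step turns \<open>r = 0\<close> into the constant
      \<open>u \<bullet> u\<close>; all later steps only raise its degree.\<close>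
    case Nil
    then have "r = 0" using deg by (intro poly_eqI) simp
    then show ?thesis using Nil by simp
  next
    case (Cons t' ts')
    then show ?thesis using lead deg[of "length ts"] by (simp add: coeff_pCons split: nat.splits)
  qed
  ultimately show ?case by blast
qed

end

text \<open>Multiplying by all main factors makes the leftover resolvent term vanish, since these
  factors kill \<open>u\<close>. What remains is a polynomial with a coefficient
  \<open>u \<bullet> u\<close>, nonzero because \<open>u\<close> is.\<close>

lemma main_function_numerator:
  assumes A: "A \<in> carrier_mat n n" and sym: "transpose_mat A = A"
    and u: "u \<in> carrier_vec n" "u \<noteq> 0\<^sub>v n"
  shows "\<exists>r. r \<noteq> 0 \<and> to_fract (main_poly A u) * main_function A u = to_fract r"
proof -
  define ms where "ms = sorted_list_of_set {\<theta>. main_eigenvalue A u \<theta>}"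
  have fin: "finite {\<theta>. main_eigenvalue A u \<theta>}"
    by (rule finite_subset[OF _ finite_eigenvalues[OF A]]) (auto simp: main_eigenvalue_def)
  have ms: "set ms = {\<theta>. main_eigenvalue A u \<theta>}" "distinct ms"
    using fin by (simp_all add: ms_def)
  have z: "shifts_mult A ms u = 0\<^sub>v n"
    by (rule main_eigenvalues_annihilate[OF A sym u(1)]) (simp add: ms)
  \<comment> \<open>For an empty list the annihilation statement would read
    \<open>u = 0\<close>.\<close>
  then have "ms \<noteq> []" using u by auto
  have mp: "main_poly A u = (\<Prod>t\<leftarrow>ms. [:- t, 1:])"
    using ms by (simp add: main_poly_def prod.distinct_set_conv_list flip: ms(1))
  define emb :: "real \<Rightarrow> real poly fract" where "emb = (\<lambda>c. to_fract [:c:])"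
  obtain r where r: "to_fract (\<Prod>t\<leftarrow>ms. [:- t, 1:]) * resolvent_form A emb u u =
      to_fract r + resolvent_form A emb u (shifts_mult A ms u)"
    "coeff r (length ms - 1) = u \<bullet> u"
    using resolvent_form_shifts[OF A emb_def u(1), of ms] \<open>ms \<noteq> []\<close> by blast
  have "resolvent_form A emb u (0\<^sub>v n) = 0"
  proof -
    have "map_vec emb (0\<^sub>v n) = 0\<^sub>v n" by (intro eq_vecI) (auto simp: emb_def)
    moreover have "resolvent A *\<^sub>v 0\<^sub>v n = 0\<^sub>v n"
      using resolvent_inverse(1)[OF A] by (intro eq_vecI) auto
    ultimately show ?thesis using u by (simp add: resolvent_form_def[OF A emb_def])
  qed
  moreover have "main_function A u = resolvent_form A emb u u"
    by (subst resolvent_form_def[OF A emb_def]) (simp only: main_function_def Let_def emb_def)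
  moreover have "r \<noteq> 0" using r(2) scalar_prod_self_eq_0[OF u(1)] u(2) by auto
  ultimately show ?thesis using r(1) z mp by auto
qed

subsection \<open>Root multisets\<close>

lemma mset_eq_sum_replicate:
  assumes "finite B" "set_mset M \<subseteq> B"
  shows "M = (\<Sum>x\<in>B. replicate_mset (count M x) x)"
proof (rule multiset_eqI)
  fix x
  have "count (\<Sum>y\<in>B. replicate_mset (count M y) y) x = (\<Sum>y\<in>B. if x = y then count M x else 0)"
    unfolding count_sum by (rule sum.cong) auto
  also have "\<dots> = count M x"
    using assms by (auto simp: count_eq_zero_iff)
  finally show "count M x = count (\<Sum>y\<in>B. replicate_mset (count M y) y) x" by simp
qed

lemma complex_roots_1 [simp]: "complex_roots 1 = {#}"
  by (simp add: complex_roots_def)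

lemma complex_roots_mult: "p \<noteq> 0 \<Longrightarrow> q \<noteq> 0 \<Longrightarrow> complex_roots (p * q) = complex_roots p + complex_roots q"
proof -
  interpret poly: map_poly_inj_comm_ring_hom complex_of_real ..
  show "p \<noteq> 0 \<Longrightarrow> q \<noteq> 0 \<Longrightarrow> complex_roots (p * q) = complex_roots p + complex_roots q"
    by (simp add: complex_roots_def poly.hom_mult proots_mult)
qed

lemma complex_roots_prod:
  assumes "\<And>x. x \<in> I \<Longrightarrow> p x \<noteq> 0"
  shows "complex_roots (\<Prod>x\<in>I. p x) = (\<Sum>x\<in>I. complex_roots (p x))"
  using assms
proof (induction I rule: infinite_finite_induct)
  case (insert x I)
  then show ?case by (simp add: complex_roots_mult)
qed simp_all

lemma complex_roots_linear: "complex_roots [:- a, 1:] = {#complex_of_real a#}"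
  by (simp add: complex_roots_def map_poly_pCons)

lemma complex_roots_main_poly:
  "complex_roots (main_poly A u) = (\<Sum>\<theta> | main_eigenvalue A u \<theta>. {#complex_of_real \<theta>#})"
  by (simp add: main_poly_def complex_roots_prod complex_roots_linear)

text \<open>As the characteristic polynomial splits over the reals, every complex root comes from a
  real eigenvalue. Positivity of the multiplicities is what makes the later subtraction of 1
  exact.\<close>

lemma spectrum_mset_symmetric:
  assumes A: "A \<in> carrier_mat n n" and sym: "transpose_mat A = A"
  shows "spectrum_mset A =
    (\<Sum>\<theta> | eigenvalue A \<theta>. replicate_mset (eigenvalue_mult A \<theta>) (complex_of_real \<theta>))"
    and "eigenvalue A \<theta> \<Longrightarrow> eigenvalue_mult A \<theta> > 0"
proof -
  obtain es where es: "char_poly A = (\<Prod>a\<leftarrow>es. [:- a, 1:])"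
    using symmetric_char_poly_splits[OF A sym] by blast
  have spec: "spectrum_mset A = image_mset complex_of_real (mset es)"
  proof -
    have "complex_roots (\<Prod>a\<leftarrow>es. [:- a, 1:]) = image_mset complex_of_real (mset es)"
    proof (induction es)
      case (Cons a es)
      have "(\<Prod>a\<leftarrow>es. [:- a, 1:]) \<noteq> 0" by (auto simp: prod_list_zero_iff)
      then show ?case using Cons complex_roots_mult[of "[:- a, 1:]"]
        by (simp add: complex_roots_linear del: mult_pCons_left)
    qed simp
    then show ?thesis by (simp add: spectrum_mset_def es)
  qed
  have ev: "eigenvalue A \<theta> \<longleftrightarrow> \<theta> \<in> set es" for \<theta>
    unfolding eigenvalue_root_char_poly[OF A] es by (induction es) (auto simp del: mult_pCons_left)
  have "spectrum_mset A = (\<Sum>x\<in>complex_of_real ` {\<theta>. eigenvalue A \<theta>}. replicate_mset (count (spectrum_mset A) x) x)"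
    by (rule mset_eq_sum_replicate) (auto simp: finite_eigenvalues[OF A] spec ev)
  also have "\<dots> = (\<Sum>\<theta> | eigenvalue A \<theta>. replicate_mset (eigenvalue_mult A \<theta>) (complex_of_real \<theta>))"
    by (subst sum.reindex) (auto simp: eigenvalue_mult_def inj_on_def)
  finally show "spectrum_mset A =
    (\<Sum>\<theta> | eigenvalue A \<theta>. replicate_mset (eigenvalue_mult A \<theta>) (complex_of_real \<theta>))" .
  show "eigenvalue_mult A \<theta> > 0" if "eigenvalue A \<theta>"
    using that by (simp add: eigenvalue_mult_def spec ev)
qed

text \<open>One copy of each main eigenvalue is set aside as a root of \<open>main_poly A u\<close>;
  these copies cancel in the final comparison of roots.\<close>

lemma spectrum_mset_main_decomposition:
  assumes A: "A \<in> carrier_mat n n" and sym: "transpose_mat A = A"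
  shows "spectrum_mset A =
    (\<Sum>\<theta> | eigenvalue A \<theta> \<and> \<not> main_eigenvalue A u \<theta>.
      replicate_mset (eigenvalue_mult A \<theta>) (complex_of_real \<theta>)) +
    (\<Sum>\<theta> | main_eigenvalue A u \<theta>.
      replicate_mset (eigenvalue_mult A \<theta> - 1) (complex_of_real \<theta>)) +
    complex_roots (main_poly A u)"
proof -
  let ?N = "{\<theta>. eigenvalue A \<theta> \<and> \<not> main_eigenvalue A u \<theta>}" and ?M = "{\<theta>. main_eigenvalue A u \<theta>}"
  let ?r = "\<lambda>\<theta>. replicate_mset (eigenvalue_mult A \<theta>) (complex_of_real \<theta>)"
  have fin: "finite ?N" "finite ?M"
    by (rule finite_subset[OF _ finite_eigenvalues[OF A]], auto simp: main_eigenvalue_def)+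
  have split: "{\<theta>. eigenvalue A \<theta>} = ?N \<union> ?M" by (auto simp: main_eigenvalue_def)
  have "?r \<theta> = replicate_mset (eigenvalue_mult A \<theta> - 1) (complex_of_real \<theta>) + {#complex_of_real \<theta>#}"
    if "main_eigenvalue A u \<theta>" for \<theta>
    using spectrum_mset_symmetric(2)[OF A sym, of \<theta>] that
    by (cases "eigenvalue_mult A \<theta>") (auto simp: main_eigenvalue_def)
  then have "sum ?r ?M = (\<Sum>\<theta>\<in>?M. replicate_mset (eigenvalue_mult A \<theta> - 1) (complex_of_real \<theta>) + {#complex_of_real \<theta>#})"
    by (intro sum.cong) auto
  also have "\<dots> = (\<Sum>\<theta>\<in>?M. replicate_mset (eigenvalue_mult A \<theta> - 1) (complex_of_real \<theta>)) +
      (\<Sum>\<theta>\<in>?M. {#complex_of_real \<theta>#})"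
    by (rule sum.distrib)
  finally have "sum ?r ?M = \<dots>" .
  then show ?thesis
    unfolding spectrum_mset_symmetric(1)[OF A sym] split complex_roots_main_poly
    by (subst sum.union_disjoint) (use fin in \<open>auto simp: add.assoc\<close>)
qed

subsection \<open>The generalized join\<close>

lemma to_fract_prod: "to_fract (\<Prod>x\<in>I. p x) = (\<Prod>x\<in>I. to_fract (p x))"
  by (induction I rule: infinite_finite_induct) simp_all

lemma to_fract_det: "to_fract (det M) = det (map_mat to_fract M)"
proof -
  interpret to_fract: comm_ring_hom "to_fract :: 'a :: idom \<Rightarrow> 'a fract"
    by unfold_locales auto
  show "to_fract (det M) = det (map_mat to_fract M)" for M :: "'a mat" by (simp add: to_fract.hom_det)
qed

text \<open>In the Leibniz expansion every permutation picks exactly one entry from each row, so the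
  product of all \<open>c v\<close> factors out of each summand.\<close>

lemma det_indexed_mat_scale_rows:
  fixes F :: "'a \<Rightarrow> 'a \<Rightarrow> 'c :: comm_ring_1"
  assumes "distinct hs"
  shows "det (indexed_mat hs hs (\<lambda>v w. c v * F v w)) = (\<Prod>v\<in>set hs. c v) * det (indexed_mat hs hs F)"
proof -
  let ?I = "{0..<length hs}"
  have c: "(\<Prod>i\<in>?I. c (hs ! i)) = (\<Prod>v\<in>set hs. c v)"
    using bij_betw_nth[OF assms, of ?I "set hs"]
    by (intro prod.reindex_bij_betw) (simp add: lessThan_atLeast0)
  have "(\<Prod>i\<in>?I. indexed_mat hs hs (\<lambda>v w. c v * F v w) $$ (i, p i)) =
      (\<Prod>v\<in>set hs. c v) * (\<Prod>i\<in>?I. indexed_mat hs hs F $$ (i, p i))"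
    if "p permutes ?I" for p
  proof -
    have "p i < length hs" if "i < length hs" for i
      using permutes_in_image[OF \<open>p permutes _\<close>, of i] that by simp
    then have "(\<Prod>i\<in>?I. indexed_mat hs hs (\<lambda>v w. c v * F v w) $$ (i, p i)) =
        (\<Prod>i\<in>?I. c (hs ! i) * indexed_mat hs hs F $$ (i, p i))"
      by (intro prod.cong) auto
    then show ?thesis by (simp only: prod.distrib c)
  qed
  then show ?thesis
    unfolding det_def'[OF indexed_mat_carrier] sum_distrib_left
    by (intro sum.cong) (auto simp only: mem_Collect_eq mult.left_commute)
qed

section \<open>Block diagonal matrices with rank-one couplings\<close>

definition block_indices :: "'h list \<Rightarrow> ('h \<Rightarrow> nat) \<Rightarrow> ('h \<times> nat) list" where
  "block_indices hs n = concat (map (\<lambda>v. map (Pair v) [0..<n v]) hs)"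

lemma set_block_indices: "set (block_indices hs n) = (SIGMA v : set hs. {0..<n v})"
  by (auto simp: block_indices_def)

lemma distinct_block_indices: "distinct hs \<Longrightarrow> distinct (block_indices hs n)"
  by (induction hs) (auto simp: block_indices_def distinct_map inj_on_def)

lemma sum_block_indices:
  assumes "v \<in> set hs" "\<And>w i. w \<noteq> v \<Longrightarrow> F (w, i) = 0"
  shows "sum F (set (block_indices hs n)) = (\<Sum>i = 0..<n v. F (v, i))"
proof -
  have "F p = 0" if "p \<in> set (block_indices hs n) - Pair v ` {0..<n v}" for p
    using that assms(2)[of "fst p" "snd p"] by (cases p; cases "fst p = v") (auto simp: set_block_indices)
  then have "sum F (set (block_indices hs n)) = sum F (Pair v ` {0..<n v})"
    using assms(1) by (intro sum.mono_neutral_right) (auto simp: set_block_indices)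
  then show ?thesis by (simp add: sum.reindex inj_on_def)
qed

text \<open>The matrix is \<open>D - X * Y\<close> with \<open>D\<close> block diagonal and the
  inner dimension indexed by \<open>hs\<close>. The inverse \<open>E\<close> of \<open>D\<close>
  consists of the blockwise resolvents, and the entries of \<open>Y * (E * X)\<close> are the main
  functions times \<open>\<rho>\<close>.\<close>

lemma det_coupled_blocks:
  fixes A :: "'h \<Rightarrow> real mat" and u :: "'h \<Rightarrow> real vec" and \<rho> :: "'h \<Rightarrow> 'h \<Rightarrow> real poly fract"
  assumes hs: "distinct hs" and A: "\<And>v. v \<in> set hs \<Longrightarrow> A v \<in> carrier_mat (n v) (n v)"
    and u: "\<And>v. v \<in> set hs \<Longrightarrow> u v \<in> carrier_vec (n v)"
  shows "det (indexed_mat (block_indices hs n) (block_indices hs n) (\<lambda>(v, i) (w, j).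
      (if v = w then map_mat to_fract (char_poly_matrix (A v)) $$ (i, j) else 0) -
      to_fract [:u v $ i:] * \<rho> v w * to_fract [:u w $ j:])) =
    (\<Prod>v\<in>set hs. to_fract (char_poly (A v))) *
    det (indexed_mat hs hs (\<lambda>v w. (if v = w then 1 else 0) - main_function (A v) (u v) * \<rho> v w))"
proof -
  let ?Z = "block_indices hs n"
  let ?M = "\<lambda>v. map_mat to_fract (char_poly_matrix (A v))"
  define d where "d = (\<lambda>(v, i) (w, j). if v = w then ?M v $$ (i, j) else 0)"
  define e where "e = (\<lambda>(v, i) (w, j). if v = w then resolvent (A v) $$ (i, j) else 0)"
  define x where "x = (\<lambda>(v, i) w. to_fract [:u v $ i:] * \<rho> v w)"
  define y where "y = (\<lambda>w (v, i). if v = w then to_fract [:u v $ i:] else 0)"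
  note Z = distinct_block_indices[OF hs, of n]
  have M: "?M v \<in> carrier_mat (n v) (n v)" if "v \<in> set hs" for v using A[OF that] by simp
  note R = resolvent_inverse[OF A]
  have de: "(\<Sum>q\<in>set ?Z. d p q * e q r) = (if p = r then 1 else 0)"
    if "p \<in> set ?Z" "r \<in> set ?Z" for p r
  proof -
    obtain v i w j where pr: "p = (v, i)" "r = (w, j)" by fastforce
    have v: "v \<in> set hs" "i < n v" and w: "w \<in> set hs" "j < n w"
      using that by (auto simp: pr set_block_indices)
    have "(\<Sum>q\<in>set ?Z. d p q * e q r) = (\<Sum>l = 0..<n v. d p (v, l) * e (v, l) r)"
      using v by (intro sum_block_indices) (auto simp: d_def pr)
    also have "\<dots> = (if v = w then (\<Sum>l = 0..<n v. ?M v $$ (i, l) * resolvent (A v) $$ (l, j)) else 0)"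
      by (simp add: d_def e_def pr)
    also have "\<dots> = (if v = w then (?M v * resolvent (A v)) $$ (i, j) else 0)"
    proof (cases "v = w")
      case True
      then show ?thesis using v w M[OF v(1)] R(1)[OF v(1)]
        by (subst index_mult_mat) (auto simp: scalar_prod_def)
    qed simp
    finally have eq: "(\<Sum>q\<in>set ?Z. d p q * e q r) = (if v = w then (?M v * resolvent (A v)) $$ (i, j) else 0)" .
    show ?thesis unfolding eq R(2)[OF v(1)] using v w by (auto simp: pr)
  qed
  have ex: "(\<Sum>q\<in>set ?Z. e (v, i) q * x q w) =
      (resolvent (A v) *\<^sub>v map_vec (\<lambda>c. to_fract [:c:]) (u v)) $ i * \<rho> v w"
    if v: "v \<in> set hs" "i < n v" for v i w
  proof -
    have "(\<Sum>q\<in>set ?Z. e (v, i) q * x q w) = (\<Sum>l = 0..<n v. e (v, i) (v, l) * x (v, l) w)"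
      using v by (intro sum_block_indices) (auto simp: e_def)
    then show ?thesis using R(1)[OF v(1)] u[OF v(1)] v
      by (simp add: e_def x_def scalar_prod_def sum_distrib_right mult.assoc)
  qed
  \<comment> \<open>Row \<open>v\<close> of \<open>?Y\<close> is supported on block
    \<open>v\<close>, so the double sum collapses to the quadratic form of the resolvent of
    \<open>A v\<close> at \<open>u v\<close>.\<close>
  have yex: "(\<Sum>p\<in>set ?Z. y v p * (\<Sum>q\<in>set ?Z. e p q * x q w)) = main_function (A v) (u v) * \<rho> v w"
    if v: "v \<in> set hs" for v w
  proof -
    have "(\<Sum>p\<in>set ?Z. y v p * (\<Sum>q\<in>set ?Z. e p q * x q w)) =
        (\<Sum>i = 0..<n v. y v (v, i) * (\<Sum>q\<in>set ?Z. e (v, i) q * x q w))"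
      using v by (intro sum_block_indices) (auto simp: y_def)
    also have "\<dots> = (\<Sum>i = 0..<n v. to_fract [:u v $ i:] *
        ((resolvent (A v) *\<^sub>v map_vec (\<lambda>c. to_fract [:c:]) (u v)) $ i * \<rho> v w))"
      using v by (intro sum.cong) (auto simp: y_def ex)
    finally show ?thesis using R(1)[OF v] u[OF v]
      by (simp add: main_function_def scalar_prod_def sum_distrib_right mult.assoc)
  qed
  have xy: "(\<Sum>v\<in>set hs. x p v * y v q) = to_fract [:u (fst p) $ snd p:] * \<rho> (fst p) (fst q) * to_fract [:u (fst q) $ snd q:]"
    if "q \<in> set ?Z" for p q
  proof -
    have "(\<Sum>v\<in>set hs. x p v * y v q) = (\<Sum>v\<in>set hs. if fst q = v then x p v * to_fract [:u (fst q) $ snd q:] else 0)"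
      by (intro sum.cong) (auto simp: y_def split: prod.splits)
    then show ?thesis using that by (auto simp: x_def set_block_indices split: prod.splits)
  qed
  let ?D = "indexed_mat ?Z ?Z d" and ?E = "indexed_mat ?Z ?Z e"
    and ?X = "indexed_mat ?Z hs x" and ?Y = "indexed_mat hs ?Z y"
  have DE: "?D * ?E = 1\<^sub>m (length ?Z)"
    unfolding indexed_mat_mult[OF Z] one_mat_indexed[OF Z] by (rule indexed_mat_cong) (rule de)
  have "det (?D - ?X * ?Y) = det ?D * det (1\<^sub>m (length hs) - ?Y * (?E * ?X))"
    by (rule det_minus_mult[OF _ _ DE]) simp_all
  also have "?D - ?X * ?Y = indexed_mat ?Z ?Z (\<lambda>(v, i) (w, j).
      (if v = w then ?M v $$ (i, j) else 0) - to_fract [:u v $ i:] * \<rho> v w * to_fract [:u w $ j:])"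
    unfolding indexed_mat_mult[OF hs] indexed_mat_diff
    by (rule indexed_mat_cong) (auto simp: xy d_def split: prod.splits)
  also have "det ?D = (\<Prod>v\<in>set hs. to_fract (char_poly (A v)))"
  proof -
    have "det ?D = (\<Prod>v\<in>set hs. det (indexed_mat (map (Pair v) [0..<n v]) (map (Pair v) [0..<n v]) d))"
      unfolding block_indices_def using hs by (intro det_indexed_mat_concat) (auto simp: d_def)
    also have "\<dots> = (\<Prod>v\<in>set hs. to_fract (char_poly (A v)))"
    proof (rule prod.cong)
      fix v assume v: "v \<in> set hs"
      have "indexed_mat (map (Pair v) [0..<n v]) (map (Pair v) [0..<n v]) d = ?M v"
        using M[OF v] by (intro eq_matI) (auto simp: d_def simp del: index_map_mat)
      then show "det (indexed_mat (map (Pair v) [0..<n v]) (map (Pair v) [0..<n v]) d) = to_fract (char_poly (A v))"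
        by (simp add: char_poly_def to_fract_det)
    qed simp
    finally show ?thesis .
  qed
  also have "1\<^sub>m (length hs) - ?Y * (?E * ?X) =
      indexed_mat hs hs (\<lambda>v w. (if v = w then 1 else 0) - main_function (A v) (u v) * \<rho> v w)"
    unfolding indexed_mat_mult[OF Z] one_mat_indexed[OF hs] indexed_mat_diff
    by (rule indexed_mat_cong) (simp add: yex)
  finally show ?thesis .
qed

section \<open>The adjacency matrix of the join in block form\<close>

lemma generalized_join_arc_iff:
  "((v, x), (w, y)) \<in> parcs (generalized_join H G S) \<longleftrightarrow>
    (v \<in> pverts H \<and> v = w \<and> (x, y) \<in> parcs (G v)) \<or> ((v, w) \<in> parcs H \<and> x \<in> S v \<and> y \<in> S w)"
  by (auto simp: generalized_join_def)

lemma adjacency_matrix_carrier [simp]: "adjacency_matrix G xs \<in> carrier_mat (length xs) (length xs)"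
  by (simp add: adjacency_matrix_def)

lemma adjacency_matrix_symmetric:
  assumes "pair_graph G"
  shows "transpose_mat (adjacency_matrix G xs) = adjacency_matrix G xs"
proof -
  interpret pair_graph G by fact
  have "(x, y) \<in> parcs G \<longleftrightarrow> (y, x) \<in> parcs G" for x y
    using pair_sym_arcs[unfolded symmetric_def with_proj_simps] by (auto dest: symD)
  then show ?thesis by (intro eq_matI) (auto simp: adjacency_matrix_def)
qed

lemma to_fract_char_poly_matrix_adjacency:
  assumes "i < length xs" "j < length xs"
  shows "map_mat to_fract (char_poly_matrix (adjacency_matrix G xs)) $$ (i, j) =
    (if i = j then to_fract [:0, 1:] else 0) - to_fract [:if (xs ! i, xs ! j) \<in> parcs G then 1 else 0:]"
proof -
  note C = adjacency_matrix_carrier[of G xs]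
  have "adjacency_matrix G xs $$ (i, j) = (if (xs ! i, xs ! j) \<in> parcs G then 1 else 0)"
    using assms by (simp add: adjacency_matrix_def)
  then show ?thesis
    using to_fract_char_poly_matrix_index[OF C assms] carrier_matD[OF char_poly_matrix_closed[OF C]] assms
    by simp
qed

text \<open>The vertices are renumbered by pairs of a block and a position in it, through the
  bijection \<open>h\<close>; in this order the characteristic matrix has the coupled block shape
  treated before.\<close>

lemma det_adjacency_generalized_join:
  fixes H :: "'h pair_pre_digraph" and G :: "'h \<Rightarrow> 'a pair_pre_digraph"
  assumes H: "pair_graph H" and hs: "enumerates hs (pverts H)"
    and xs: "\<And>v. v \<in> pverts H \<Longrightarrow> enumerates (xs v) (pverts (G v))"
    and zs: "enumerates zs (pverts (generalized_join H G S))"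
  shows "to_fract (char_poly (adjacency_matrix (generalized_join H G S) zs)) =
    (\<Prod>v\<in>pverts H. to_fract (char_poly (adjacency_matrix (G v) (xs v)))) *
    det (indexed_mat hs hs (\<lambda>v w. (if v = w then 1 else 0) -
      main_function (adjacency_matrix (G v) (xs v)) (characteristic_vec (S v) (xs v)) *
      (if (v, w) \<in> parcs H then 1 else 0)))"
proof -
  interpret H: pair_graph H by (rule H)
  let ?J = "generalized_join H G S" and ?x = "to_fract [:0, 1:] :: real poly fract"
  let ?A = "\<lambda>v. adjacency_matrix (G v) (xs v)" and ?u = "\<lambda>v. characteristic_vec (S v) (xs v)"
  let ?n = "\<lambda>v. length (xs v)"
  let ?Z = "block_indices hs ?n"
  let ?F = "\<lambda>p q. (if p = q then ?x else 0) - to_fract [:if (p, q) \<in> parcs ?J then 1 else 0:]"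
  define h where "h = (\<lambda>(v, i). (v, xs v ! i))"
  have dhs: "distinct hs" and shs: "set hs = pverts H" using hs by (auto simp: enumerates_def)
  have dxs: "distinct (xs v)" and sxs: "set (xs v) = pverts (G v)" if "v \<in> pverts H" for v
    using xs[OF that] by (auto simp: enumerates_def)
  have dzs: "distinct zs" and szs: "set zs = (SIGMA v : pverts H. pverts (G v))"
    using zs by (auto simp: enumerates_def generalized_join_def)
  have inj: "inj_on h (set ?Z)"
    by (auto simp: inj_on_def h_def set_block_indices shs nth_eq_iff_index_eq dxs)
  have "(!) (xs v) ` {0..<?n v} = pverts (G v)" if "v \<in> pverts H" for v
    unfolding sxs[OF that, symmetric] by (auto simp: set_conv_nth)
  then have "set (map h ?Z) = set zs"
    by (force simp: h_def set_block_indices szs shs)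
  moreover have "distinct (map h ?Z)"
    using inj distinct_block_indices[OF dhs] by (simp add: distinct_map)
  ultimately have "det (indexed_mat zs zs ?F) = det (indexed_mat (map h ?Z) (map h ?Z) ?F)"
    using dzs by (intro det_indexed_mat_reorder) auto
  moreover have "map_mat to_fract (char_poly_matrix (adjacency_matrix ?J zs)) = indexed_mat zs zs ?F"
    using carrier_matD[OF char_poly_matrix_closed[OF adjacency_matrix_carrier[of ?J zs]]]
    by (intro eq_matI)
      (simp_all add: to_fract_char_poly_matrix_adjacency nth_eq_iff_index_eq[OF dzs] del: index_map_mat(1))
  ultimately have "to_fract (char_poly (adjacency_matrix ?J zs)) = det (indexed_mat (map h ?Z) (map h ?Z) ?F)"
    by (simp add: char_poly_def to_fract_det)
  also have "indexed_mat (map h ?Z) (map h ?Z) ?F = indexed_mat ?Z ?Z (\<lambda>(v, i) (w, j).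
      (if v = w then map_mat to_fract (char_poly_matrix (?A v)) $$ (i, j) else 0) -
      to_fract [:?u v $ i:] * (if (v, w) \<in> parcs H then 1 else 0) * to_fract [:?u w $ j:])"
    unfolding indexed_mat_map
  proof (rule indexed_mat_cong)
    fix p q assume "p \<in> set ?Z" "q \<in> set ?Z"
    then obtain v i w j where p: "p = (v, i)" "v \<in> pverts H" "i < ?n v" and q: "q = (w, j)" "w \<in> pverts H" "j < ?n w"
      by (auto simp: set_block_indices shs)
    have arc: "(h p, h q) \<in> parcs ?J \<longleftrightarrow> (v = w \<and> (xs v ! i, xs v ! j) \<in> parcs (G v)) \<or>
        ((v, w) \<in> parcs H \<and> xs v ! i \<in> S v \<and> xs w ! j \<in> S w)"
      using p q by (auto simp: h_def generalized_join_arc_iff)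
    have eq: "h p = h q \<longleftrightarrow> v = w \<and> i = j"
      using p q by (auto simp: h_def nth_eq_iff_index_eq dxs)
    have M: "map_mat to_fract (char_poly_matrix (?A v)) $$ (i, j) =
        (if i = j then ?x else 0) - to_fract [:if (xs v ! i, xs v ! j) \<in> parcs (G v) then 1 else 0:]"
      if "v = w"
      using p q that by (intro to_fract_char_poly_matrix_adjacency) auto
    have u: "to_fract [:?u v $ i:] = (if xs v ! i \<in> S v then 1 else 0)"
        "to_fract [:?u w $ j:] = (if xs w ! j \<in> S w then 1 else 0)"
      using p q by (simp_all add: characteristic_vec_def pCons_one)
    have "?F (h p) (h q) = (if v = w then map_mat to_fract (char_poly_matrix (?A v)) $$ (i, j) else 0) -
      to_fract [:?u v $ i:] * (if (v, w) \<in> parcs H then 1 else 0) * to_fract [:?u w $ j:]"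
    \<comment> \<open>Within a block the coupling vanishes because \<open>H\<close> has no loops;
      across blocks the diagonal and the arcs of \<open>G v\<close> drop out and only couplings from
      \<open>H\<close> remain.\<close>
    proof (cases "v = w")
      case True
      then have "(v, w) \<notin> parcs H" using H.pair_no_loops[of "(v, w)"] by auto
      then show ?thesis unfolding eq arc M[OF True] by (simp add: True)
    next
      case False
      then show ?thesis unfolding eq arc u by (simp add: pCons_one)
    qed
    then show "?F (h p) (h q) = (case p of (v, i) \<Rightarrow> \<lambda>(w, j).
      (if v = w then map_mat to_fract (char_poly_matrix (?A v)) $$ (i, j) else 0) -
      to_fract [:?u v $ i:] * (if (v, w) \<in> parcs H then 1 else 0) * to_fract [:?u w $ j:]) q"
      unfolding p(1) q(1) by (simp only: prod.case)
  qed
  also have "det \<dots> = (\<Prod>v\<in>set hs. to_fract (char_poly (?A v))) *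
      det (indexed_mat hs hs (\<lambda>v w. (if v = w then 1 else 0) - main_function (?A v) (?u v) *
        (if (v, w) \<in> parcs H then 1 else 0)))"
    by (rule det_coupled_blocks[OF dhs]) (simp_all add: characteristic_vec_def)
  finally show ?thesis by (simp add: shs)
qed

theorem theorem5p4:
  fixes H :: "'h pair_pre_digraph" and hs :: "'h list" and k :: nat
    and G :: "'h \<Rightarrow> 'a pair_pre_digraph" and S :: "'h \<Rightarrow> 'a set"
    and xs :: "'h \<Rightarrow> 'a list" and zs :: "('h \<times> 'a) list"
    and A :: "'h \<Rightarrow> real mat" and \<chi> :: "'h \<Rightarrow> real vec" and AG :: "real mat"
    and \<rho> :: "'h \<Rightarrow> 'h \<Rightarrow> real poly fract"
    and \<phi> :: "'h \<Rightarrow> real poly" and \<Gamma> g f :: "'h \<Rightarrow> real poly fract"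
  assumes H: "pair_graph H" and hs: "enumerates hs (pverts H)" and k: "k = length hs"
    and G: "\<And>v. v \<in> pverts H \<Longrightarrow> pair_graph (G v)"
    and S: "\<And>v. v \<in> pverts H \<Longrightarrow> S v \<subseteq> pverts (G v)" "\<And>v. v \<in> pverts H \<Longrightarrow> S v \<noteq> {}"
    and xs: "\<And>v. v \<in> pverts H \<Longrightarrow> enumerates (xs v) (pverts (G v))"
    and zs: "enumerates zs (pverts (generalized_join H G S))"
    and A: "\<And>v. A v = adjacency_matrix (G v) (xs v)"
    and \<chi>: "\<And>v. \<chi> v = characteristic_vec (S v) (xs v)"
    and AG: "AG = adjacency_matrix (generalized_join H G S) zs"
    and \<rho>: "\<And>v w. \<rho> v w = (if (v, w) \<in> parcs H then 1 else 0)"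
    and \<phi>: "\<And>v. \<phi> v = char_poly (A v)"
    and \<Gamma>: "\<And>v. \<Gamma> v = main_function (A v) (\<chi> v)"
    and g: "\<And>v. g v = to_fract (main_poly (A v) (\<chi> v))"
    and f: "\<And>v. f v = g v * \<Gamma> v"
  shows "to_fract (char_poly AG) =
           (\<Prod>v\<in>pverts H. to_fract (\<phi> v) * \<Gamma> v) *
           det (mat k k (\<lambda>(i, j). if i = j then 1 / \<Gamma> (hs ! i) else - \<rho> (hs ! i) (hs ! j))) \<and>
         (\<exists>\<Phi> :: real poly. \<Phi> \<noteq> 0 \<and>
           to_fract \<Phi> =
             det (mat k k (\<lambda>(i, j). if i = j then g (hs ! i)
                                    else - (\<rho> (hs ! i) (hs ! j) * f (hs ! i)))) \<and>
           spectrum_mset AG =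
             (\<Sum>v\<in>pverts H. \<Sum>\<theta> | eigenvalue (A v) \<theta> \<and> \<not> main_eigenvalue (A v) (\<chi> v) \<theta>.
                replicate_mset (eigenvalue_mult (A v) \<theta>) (complex_of_real \<theta>)) +
             (\<Sum>v\<in>pverts H. \<Sum>\<theta> | main_eigenvalue (A v) (\<chi> v) \<theta>.
                replicate_mset (eigenvalue_mult (A v) \<theta> - 1) (complex_of_real \<theta>)) +
             complex_roots \<Phi>)"
proof -
  interpret H: pair_graph H by (rule H)
  let ?V = "pverts H"
  define P where "P v = main_poly (A v) (\<chi> v)" for v
  define C where "C = indexed_mat hs hs (\<lambda>v w. (if v = w then 1 else 0) - \<Gamma> v * \<rho> v w)"
  have dhs: "distinct hs" and shs: "set hs = ?V" using hs by (auto simp: enumerates_def)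
  have loop: "\<rho> v v = 0" for v using H.pair_no_loops[of "(v, v)"] by (auto simp: \<rho>)
  have carrier: "A v \<in> carrier_mat (length (xs v)) (length (xs v))" for v by (simp add: A)
  have sym: "transpose_mat (A v) = A v" if "v \<in> ?V" for v
    unfolding A by (rule adjacency_matrix_symmetric[OF G[OF that]])
  have "\<exists>r. r \<noteq> 0 \<and> to_fract (P v) * \<Gamma> v = to_fract r" if v: "v \<in> ?V" for v
  proof -
    have u: "\<chi> v \<in> carrier_vec (length (xs v))" by (simp add: \<chi> characteristic_vec_def)
    \<comment> \<open>Nonemptiness of \<open>S v\<close> enters here: it makes
      \<open>\<chi> v\<close> nonzero, hence also the numerator of
      \<open>\<Gamma> v\<close>.\<close>
    obtain x where "x \<in> S v" "x \<in> set (xs v)" using S[OF v] xs[OF v] by (auto simp: enumerates_def)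
    then obtain i where "i < length (xs v)" "xs v ! i \<in> S v" by (auto simp: in_set_conv_nth)
    then have "\<chi> v $ i = 1" "i < length (xs v)" by (simp_all add: \<chi> characteristic_vec_def)
    then have "\<chi> v \<noteq> 0\<^sub>v (length (xs v))" by auto
    then show ?thesis unfolding P_def \<Gamma> by (rule main_function_numerator[OF carrier sym[OF v] u])
  qed
  then obtain r where r: "\<And>v. v \<in> ?V \<Longrightarrow> r v \<noteq> 0" "\<And>v. v \<in> ?V \<Longrightarrow> to_fract (P v) * \<Gamma> v = to_fract (r v)"
    by metis
  have \<Gamma>0: "\<Gamma> v \<noteq> 0" and P0: "P v \<noteq> 0" if "v \<in> ?V" for v using r[OF that] by auto
  have "to_fract (char_poly AG) = (\<Prod>v\<in>?V. to_fract (\<phi> v)) * det C"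
    unfolding C_def \<phi> \<Gamma> \<rho> A \<chi> AG by (rule det_adjacency_generalized_join[OF H hs xs zs])
  note join = this
  \<comment> \<open>Since \<open>\<Gamma> v \<noteq> 0\<close>, it can be pulled out of row
    \<open>v\<close>; the vanishing of \<open>\<rho> v v\<close> leaves
    \<open>1 / \<Gamma> v\<close> on the diagonal.\<close>
  have "C = indexed_mat hs hs (\<lambda>v w. \<Gamma> v * (if v = w then 1 / \<Gamma> v else - \<rho> v w))"
    unfolding C_def by (rule indexed_mat_cong) (simp add: loop \<Gamma>0 shs)
  then have "det C = (\<Prod>v\<in>?V. \<Gamma> v) * det (indexed_mat hs hs (\<lambda>v w. if v = w then 1 / \<Gamma> v else - \<rho> v w))"
    using det_indexed_mat_scale_rows[OF dhs, of \<Gamma>] by (simp add: shs)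
  also have "indexed_mat hs hs (\<lambda>v w. if v = w then 1 / \<Gamma> v else - \<rho> v w) =
      mat k k (\<lambda>(i, j). if i = j then 1 / \<Gamma> (hs ! i) else - \<rho> (hs ! i) (hs ! j))"
    by (rule eq_matI) (auto simp: k nth_eq_iff_index_eq[OF dhs])
  finally have part1: "to_fract (char_poly AG) =
      (\<Prod>v\<in>?V. to_fract (\<phi> v) * \<Gamma> v) *
      det (mat k k (\<lambda>(i, j). if i = j then 1 / \<Gamma> (hs ! i) else - \<rho> (hs ! i) (hs ! j)))"
    using join by (simp add: prod.distrib mult.assoc)

  \<comment> \<open>Replacing each \<open>f v\<close> by its polynomial representative
    \<open>r v\<close> yields a determinant over polynomials, so \<open>\<Phi>\<close> is a genuine
    polynomial and has roots.\<close>
  define \<Phi> where "\<Phi> = det (indexed_mat hs hs (\<lambda>v w. if v = w then P v else if (v, w) \<in> parcs H then - r v else 0))"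
  have "map_mat to_fract (indexed_mat hs hs (\<lambda>v w. if v = w then P v else if (v, w) \<in> parcs H then - r v else 0)) =
      mat k k (\<lambda>(i, j). if i = j then g (hs ! i) else - (\<rho> (hs ! i) (hs ! j) * f (hs ! i)))"
    using r(2) by (intro eq_matI) (auto simp: k nth_eq_iff_index_eq[OF dhs] g f \<rho> P_def shs[symmetric])
  then have \<Phi>: "to_fract \<Phi> = det (mat k k (\<lambda>(i, j). if i = j then g (hs ! i) else - (\<rho> (hs ! i) (hs ! j) * f (hs ! i))))"
    by (simp add: \<Phi>_def to_fract_det)
  also have "mat k k (\<lambda>(i, j). if i = j then g (hs ! i) else - (\<rho> (hs ! i) (hs ! j) * f (hs ! i))) =
      indexed_mat hs hs (\<lambda>v w. g v * ((if v = w then 1 else 0) - \<Gamma> v * \<rho> v w))"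
    by (rule eq_matI) (auto simp: k nth_eq_iff_index_eq[OF dhs] f loop)
  also have "det \<dots> = (\<Prod>v\<in>?V. g v) * det C"
    unfolding det_indexed_mat_scale_rows[OF dhs] C_def shs ..
  \<comment> \<open>Both determinants are row scalings of the same \<open>C\<close>, so eliminating
    \<open>det C\<close> leaves an identity between polynomials.\<close>
  finally have "to_fract (char_poly AG * (\<Prod>v\<in>?V. P v)) = to_fract ((\<Prod>v\<in>?V. \<phi> v) * \<Phi>)"
    using join by (simp add: to_fract_prod g P_def)
  then have eq: "char_poly AG * (\<Prod>v\<in>?V. P v) = (\<Prod>v\<in>?V. \<phi> v) * \<Phi>"
    by (simp only: to_fract_eq_iff)
  have nz: "char_poly AG \<noteq> 0" "(\<Prod>v\<in>?V. P v) \<noteq> 0"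
    using degree_monic_char_poly[of AG "length zs"] P0 by (auto simp: AG)
  \<comment> \<open>Root multisets add up only for nonzero factors; that \<open>\<Phi>\<close> is
    nonzero is read off from the other side of \<open>eq\<close>.\<close>
  then have "(\<Prod>v\<in>?V. \<phi> v) * \<Phi> \<noteq> 0" using eq by (metis mult_eq_0_iff)
  then have nz': "(\<Prod>v\<in>?V. \<phi> v) \<noteq> 0" "\<Phi> \<noteq> 0" "\<And>v. v \<in> ?V \<Longrightarrow> \<phi> v \<noteq> 0" by auto
  let ?N = "\<lambda>v. \<Sum>\<theta> | eigenvalue (A v) \<theta> \<and> \<not> main_eigenvalue (A v) (\<chi> v) \<theta>.
      replicate_mset (eigenvalue_mult (A v) \<theta>) (complex_of_real \<theta>)"
  let ?M = "\<lambda>v. \<Sum>\<theta> | main_eigenvalue (A v) (\<chi> v) \<theta>.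
      replicate_mset (eigenvalue_mult (A v) \<theta> - 1) (complex_of_real \<theta>)"
  have "spectrum_mset AG + (\<Sum>v\<in>?V. complex_roots (P v)) = (\<Sum>v\<in>?V. complex_roots (\<phi> v)) + complex_roots \<Phi>"
    using arg_cong[OF eq, of complex_roots] nz nz' P0
    by (simp add: spectrum_mset_def complex_roots_mult complex_roots_prod)
  also have "(\<Sum>v\<in>?V. complex_roots (\<phi> v)) = (\<Sum>v\<in>?V. ?N v + ?M v + complex_roots (P v))"
    unfolding \<phi> P_def spectrum_mset_def[symmetric]
    by (intro sum.cong refl spectrum_mset_main_decomposition[OF carrier sym])
  also have "\<dots> = (\<Sum>v\<in>?V. ?N v) + (\<Sum>v\<in>?V. ?M v) + (\<Sum>v\<in>?V. complex_roots (P v))"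
    by (simp only: sum.distrib)
  \<comment> \<open>The roots of the \<open>P v\<close> occur on both sides and cancel.\<close>
  finally have "spectrum_mset AG = (\<Sum>v\<in>?V. ?N v) + (\<Sum>v\<in>?V. ?M v) + complex_roots \<Phi>"
    by (simp add: ac_simps)
  then show ?thesis using part1 \<Phi> nz'(2) by blast
qed

end
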